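(* Let $X$ be a nonempty finite interval of positive integers with $1\notin X$ (that is, $X=\{a,a+1,\dots,b\}$ for some integers $2\le a\le b$). Then there exist a finite set $\Omega$ and a primitive permutation group $G$ on $\Omega$ such that $\mathcal{I}(G,\Omega)=X$.
   Context: For a finite permutation group $G$ on a finite set $\Omega$, an ordered sequence $(\omega_1,\dots,\omega_\ell)$ of elements of $\Omega$ is an irredundant base for $G$ if all inclusions in the stabilizer chain $G\ge G_{\omega_1}\ge G_{\omega_1,\omega_2}\ge\cdots\ge G_{\omega_1,\dots,\omega_\ell}$ are strict and $G_{\omega_1,\dots,\omega_\ell}=1$. Here $G_{\omega_1,\dots,\omega_i}$ denotes the pointwise stabilizer. Define $$\mathcal{I}(G,\Omega)=\{\ell\in\mathbb{N} : \text{there exist } \omega_1,\dots,\omega_\ell\in\Omega \text{ such that } (\omega_1,\dots,\omega_\ell)\text{ is an irredundant base for } G\}.$$ *)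

theory Defs
  imports "HOL-Algebra.Group_Action"
begin

definition permutation_group :: "('a \<Rightarrow> 'a) set \<Rightarrow> 'a set \<Rightarrow> bool" where
  "permutation_group G \<Omega> \<longleftrightarrow> finite \<Omega> \<and> subgroup G (BijGroup \<Omega>)"

definition is_block :: "('a \<Rightarrow> 'a) set \<Rightarrow> 'a set \<Rightarrow> 'a set \<Rightarrow> bool" where
  "is_block G \<Omega> B \<longleftrightarrow>
     B \<subseteq> \<Omega> \<and> B \<noteq> {} \<and> (\<forall>g\<in>G. g ` B = B \<or> g ` B \<inter> B = {})"

text \<open>Primitive groups are required to be transitive; this matters only when
  \<open>\<Omega>\<close> has two points and \<open>G\<close> is trivial.\<close>

definition primitive_permutation_group :: "('a \<Rightarrow> 'a) set \<Rightarrow> 'a set \<Rightarrow> bool" where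
  "primitive_permutation_group G \<Omega> \<longleftrightarrow>
     permutation_group G \<Omega> \<and> \<Omega> \<noteq> {} \<and>
     transitive_action (BijGroup \<Omega>\<lparr>carrier := G\<rparr>) \<Omega> (\<lambda>g. g) \<and>
     (\<forall>B. is_block G \<Omega> B \<longrightarrow> is_singleton B \<or> B = \<Omega>)"

definition pointwise_stabilizer :: "('a \<Rightarrow> 'a) set \<Rightarrow> 'a set \<Rightarrow> ('a \<Rightarrow> 'a) set" where
  "pointwise_stabilizer G A = {g \<in> G. \<forall>x\<in>A. g x = x}"

text \<open>The sequence \<open>(\<omega>\<^sub>1, \<dots>, \<omega>\<^sub>l)\<close> is a list; its first \<open>i\<close> entries are \<open>take i \<omega>s\<close>.
  The empty list is allowed, and is an irredundant base exactly for the trivial group.\<close>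

definition irredundant_base :: "('a \<Rightarrow> 'a) set \<Rightarrow> 'a set \<Rightarrow> 'a list \<Rightarrow> bool" where
  "irredundant_base G \<Omega> \<omega>s \<longleftrightarrow>
     set \<omega>s \<subseteq> \<Omega> \<and>
     (\<forall>i<length \<omega>s. pointwise_stabilizer G (set (take (Suc i) \<omega>s))
                    \<subset> pointwise_stabilizer G (set (take i \<omega>s))) \<and>
     pointwise_stabilizer G (set \<omega>s) = {\<one>\<^bsub>BijGroup \<Omega>\<^esub>}"

definition irredundant_base_sizes :: "('a \<Rightarrow> 'a) set \<Rightarrow> 'a set \<Rightarrow> nat set" where
  "irredundant_base_sizes G \<Omega> = {l. \<exists>\<omega>s. length \<omega>s = l \<and> irredundant_base G \<Omega> \<omega>s}"

end

theory Submission
  imports Defs "HOL-Algebra.Algebraic_Closure_Type" "HOL-Library.Function_Algebras"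
    "HOL-Library.Numeral_Type"
begin

text \<open>
  For a linear group \<open>H\<close> acting irreducibly on a finite vector space \<open>V\<close>, the affine group
  \<open>V : H\<close> is primitive on \<open>V\<close>, and its irredundant bases are, up to translation, the zero vector
  followed by an irredundant base of \<open>H\<close> on \<open>V\<close>.

  If \<open>a \<ge> 3\<close>, take \<open>H\<close> to be the group of all semilinear bijections of the \<open>n\<close>-dimensional
  space over the field \<open>F\<close> of order \<open>5\<close> to the power \<open>2 ^ m\<close>, with \<open>n = a - 2\<close> and
  \<open>m = b - a + 1\<close>. A base of \<open>H\<close> must contain a basis of \<open>V\<close>, whose stabilizer is
  conjugate to the Galois group of \<open>F\<close>. This is cyclic of order \<open>2 ^ m\<close>, so that any number of steps
  between \<open>1\<close> and \<open>m\<close> can be used to cut it down to the trivial group. The sizes are therefore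
  \<open>n + 1, \<dots>, n + m\<close>.

  If \<open>a = 2\<close>, take \<open>H\<close> to be the group generated by the sign changes and the cyclic shift of the
  coordinates of the \<open>n\<close>-dimensional space over the field of order \<open>5\<close>, with \<open>n = b - 1\<close>. The
  vector \<open>(1, \<dots>, 1, 2)\<close> has trivial stabilizer because \<open>2\<close> is neither \<open>1\<close> nor \<open>-1\<close>, and it can
  be preceded by any number of standard basis vectors smaller than \<open>n\<close>.
\<close>

(* The library uses X for the polynomial indeterminate, which would capture the X of the theorem. *)
no_notation Polynomials.var (\<open>X\<index>\<close>)

section \<open>Permutation groups and affine groups\<close>

text \<open>Two functions that agree on \<open>V\<close> stand for the same permutation of \<open>V\<close>; this avoids having
  to restrict linear maps to \<open>V\<close>.\<close>

definition transformation_group :: "'v set \<Rightarrow> ('v \<Rightarrow> 'v) set \<Rightarrow> bool" where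
  "transformation_group V A \<longleftrightarrow>
     (\<forall>h\<in>A. \<forall>x\<in>V. h x \<in> V) \<and>
     (\<exists>h\<in>A. \<forall>x\<in>V. h x = x) \<and>
     (\<forall>g\<in>A. \<forall>h\<in>A. \<exists>k\<in>A. \<forall>x\<in>V. k x = g (h x)) \<and>
     (\<forall>h\<in>A. \<exists>k\<in>A. \<forall>x\<in>V. k (h x) = x)"

text \<open>Strict descent is encoded by a witness that fixes the earlier points and moves the next
  one, and triviality of the last stabilizer by its action on \<open>V\<close>, so that several
  functions in \<open>A\<close> may represent one permutation.\<close>

definition irredundant_on :: "'v set \<Rightarrow> ('v \<Rightarrow> 'v) set \<Rightarrow> 'v list \<Rightarrow> bool" where
  "irredundant_on V A vs \<longleftrightarrow>
     set vs \<subseteq> V \<and>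
     (\<forall>i<length vs. \<exists>h\<in>A. (\<forall>j<i. h (vs ! j) = vs ! j) \<and> h (vs ! i) \<noteq> vs ! i) \<and>
     (\<forall>h\<in>A. (\<forall>v\<in>set vs. h v = v) \<longrightarrow> (\<forall>x\<in>V. h x = x))"

lemma transformation_group_closed:
  assumes "transformation_group V A" "h \<in> A" "x \<in> V"
  shows "h x \<in> V"
  using assms unfolding transformation_group_def by blast

lemma transformation_group_id:
  assumes "transformation_group V A"
  shows "\<exists>h\<in>A. \<forall>x\<in>V. h x = x"
  using assms unfolding transformation_group_def by simp

lemma transformation_group_comp:
  assumes "transformation_group V A" "g \<in> A" "h \<in> A"
  shows "\<exists>k\<in>A. \<forall>x\<in>V. k x = g (h x)"
  using assms unfolding transformation_group_def by simp

lemma transformation_group_inv: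
  assumes "transformation_group V A" "h \<in> A"
  shows "\<exists>k\<in>A. \<forall>x\<in>V. k (h x) = x"
  using assms unfolding transformation_group_def by simp

lemma transformation_group_bij:
  assumes "transformation_group V A" "finite V" "h \<in> A"
  shows "bij_betw h V V"
proof -
  obtain k where k: "\<And>x. x \<in> V \<Longrightarrow> k (h x) = x"
    using transformation_group_inv[OF assms(1,3)] by auto
  have "inj_on h V" by (metis inj_onI k)
  moreover have "h ` V \<subseteq> V"
    using transformation_group_closed[OF assms(1,3)] by blast
  ultimately show ?thesis
    using assms(2) by (simp add: bij_betw_def endo_inj_surj)
qed

text \<open>Prepares induction along the stabilizer chain: a witness for a later point fixes
  \<open>v\<close>, so it lies in the stabilizer of \<open>v\<close>.\<close>

lemma irredundant_on_Cons:
  assumes "irredundant_on V S (v # vs)"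
  shows "v \<in> V" "\<exists>h\<in>S. h v \<noteq> v" "irredundant_on V {h \<in> S. h v = v} vs"
proof -
  have steps: "\<exists>h\<in>S. (\<forall>j<i. h ((v # vs) ! j) = (v # vs) ! j) \<and> h ((v # vs) ! i) \<noteq> (v # vs) ! i"
    if "i < length (v # vs)" for i
    using assms that unfolding irredundant_on_def by blast
  show "v \<in> V" using assms by (simp add: irredundant_on_def)
  show "\<exists>h\<in>S. h v \<noteq> v" using steps[of 0] by simp
  have "\<exists>h\<in>{h \<in> S. h v = v}. (\<forall>j<i. h (vs ! j) = vs ! j) \<and> h (vs ! i) \<noteq> vs ! i"
    if "i < length vs" for i
  proof -
    have "\<exists>h\<in>S. (\<forall>j<Suc i. h ((v # vs) ! j) = (v # vs) ! j) \<and> h (vs ! i) \<noteq> vs ! i"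
      using steps[of "Suc i"] that by simp
    then obtain h where h: "h \<in> S" "\<And>j. j < Suc i \<Longrightarrow> h ((v # vs) ! j) = (v # vs) ! j" "h (vs ! i) \<noteq> vs ! i"
      by blast
    show ?thesis using h(1,3) h(2)[of 0] h(2)[of "Suc _"] by (intro bexI[of _ h]) auto
  qed
  then show "irredundant_on V {h \<in> S. h v = v} vs"
    using assms by (simp add: irredundant_on_def)
qed

lemma transformation_group_stabilizer:
  assumes "transformation_group V S" "v \<in> V"
  shows "transformation_group V {h \<in> S. h v = v}"
  unfolding transformation_group_def
proof (intro conjI ballI)
  show "\<exists>h\<in>{h \<in> S. h v = v}. \<forall>x\<in>V. h x = x"
    using transformation_group_id[OF assms(1)] assms(2) by auto
next
  fix g h assume gh: "g \<in> {h \<in> S. h v = v}" "h \<in> {h \<in> S. h v = v}"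
  then obtain k where "k \<in> S" "\<forall>x\<in>V. k x = g (h x)"
    using transformation_group_comp[OF assms(1)] by blast
  then show "\<exists>k\<in>{h \<in> S. h v = v}. \<forall>x\<in>V. k x = g (h x)"
    using gh assms(2) by (intro bexI[of _ k]) auto
next
  fix h assume h: "h \<in> {h \<in> S. h v = v}"
  then obtain k where "k \<in> S" "\<forall>x\<in>V. k (h x) = x"
    using transformation_group_inv[OF assms(1)] by blast
  then show "\<exists>k\<in>{h \<in> S. h v = v}. \<forall>x\<in>V. k (h x) = x"
    using h assms(2) by (intro bexI[of _ k]) (auto dest: bspec[of _ _ v])
qed (use transformation_group_closed[OF assms(1)] in auto)

section \<open>Comparison with irredundant bases of permutation groups\<close>

lemma set_take_conv_nth: "i \<le> length xs \<Longrightarrow> set (take i xs) = {xs ! j |j. j < i}"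
  by (auto simp: set_conv_nth) (metis nth_take)

text \<open>The stabilizers are nested, so an inclusion is strict exactly when an element of the
  larger one moves the next point. Elements of \<open>G\<close> are extensional, so one that fixes
  all of \<Omega> is the unit of the group.\<close>

lemma irredundant_base_iff:
  assumes "subgroup G (BijGroup \<Omega>)"
  shows "irredundant_base G \<Omega> ws \<longleftrightarrow> irredundant_on \<Omega> G ws"
proof -
  have ext: "g \<in> extensional \<Omega>" if "g \<in> G" for g
    using subgroup.subset[OF assms] that by (auto simp: BijGroup_def Bij_def)
  have one: "(\<lambda>x\<in>\<Omega>. x) \<in> G"
    using subgroup.one_closed[OF assms] by (simp add: BijGroup_def)
  have step: "pointwise_stabilizer G (set (take (Suc i) ws)) \<subset> pointwise_stabilizer G (set (take i ws))
      \<longleftrightarrow> (\<exists>h\<in>G. (\<forall>j<i. h (ws ! j) = ws ! j) \<and> h (ws ! i) \<noteq> ws ! i)" if "i < length ws" for i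
  proof -
    have "pointwise_stabilizer G (set (take k ws)) = {h \<in> G. \<forall>j<k. h (ws ! j) = ws ! j}"
      if "k \<le> length ws" for k
      using that by (auto simp: pointwise_stabilizer_def set_take_conv_nth)
    then show ?thesis using that by (auto simp: less_Suc_eq)
  qed
  have last: "pointwise_stabilizer G (set ws) = {\<one>\<^bsub>BijGroup \<Omega>\<^esub>}
      \<longleftrightarrow> (\<forall>h\<in>G. (\<forall>v\<in>set ws. h v = v) \<longrightarrow> (\<forall>x\<in>\<Omega>. h x = x))" if "set ws \<subseteq> \<Omega>"
  proof -
    have "h = (\<lambda>x\<in>\<Omega>. x) \<longleftrightarrow> (\<forall>x\<in>\<Omega>. h x = x)" if "h \<in> G" for h
      using ext[OF that] by (auto simp: extensional_def fun_eq_iff)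
    moreover have "(\<lambda>x\<in>\<Omega>. x) v = v" if "v \<in> set ws" for v
      using that \<open>set ws \<subseteq> \<Omega>\<close> by auto
    ultimately show ?thesis
      using one unfolding pointwise_stabilizer_def BijGroup_def by auto
  qed
  show ?thesis
    unfolding irredundant_base_def irredundant_on_def
    by (cases "set ws \<subseteq> \<Omega>") (simp_all add: step last)
qed

text \<open>Conjugation by a numbering \<phi> of the points yields a genuine subgroup of
  \<open>BijGroup \<Omega>\<close> and carries over transitivity, blocks and fixed points.\<close>

lemma exists_primitive_nat_copy:
  fixes V :: "'v set"
  assumes fin: "finite V" and ne: "V \<noteq> {}" and tg: "transformation_group V A"
    and trans: "\<And>x y. x \<in> V \<Longrightarrow> y \<in> V \<Longrightarrow> \<exists>g\<in>A. g x = y"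
    and prim: "\<And>B. B \<subseteq> V \<Longrightarrow> B \<noteq> {} \<Longrightarrow> \<forall>g\<in>A. g ` B = B \<or> g ` B \<inter> B = {} \<Longrightarrow> is_singleton B \<or> B = V"
  shows "\<exists>(\<Omega> :: nat set) G. primitive_permutation_group G \<Omega> \<and>
           irredundant_base_sizes G \<Omega> = length ` {vs. irredundant_on V A vs}"
proof -
  obtain \<phi> :: "'v \<Rightarrow> nat" where bij: "bij_betw \<phi> V {0..<card V}"
    using ex_bij_betw_finite_nat[OF fin] by blast
  define \<Omega> where "\<Omega> = {0..<card V}"
  define \<psi> where "\<psi> = inv_into V \<phi>"
  \<comment> \<open>Restricting to \<Omega> identifies functions that agree on
    \<open>V\<close>.\<close>
  define conj where "conj h = (\<lambda>k\<in>\<Omega>. \<phi> (h (\<psi> k)))" for h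
  define G where "G = conj ` A"
  have \<psi>\<phi>: "\<psi> (\<phi> x) = x" if "x \<in> V" for x
    using bij that by (simp add: \<psi>_def bij_betw_def)
  have \<phi>\<psi>: "\<phi> (\<psi> k) = k" if "k \<in> \<Omega>" for k
    using bij that unfolding \<psi>_def \<Omega>_def by (metis bij_betw_inv_into_right)
  have \<phi>_mem: "\<phi> x \<in> \<Omega>" if "x \<in> V" for x
    using bij that unfolding \<Omega>_def by (metis bij_betwE)
  have \<psi>_mem: "\<psi> k \<in> V" if "k \<in> \<Omega>" for k
    using bij that unfolding \<psi>_def \<Omega>_def by (metis bij_betw_inv_into bij_betwE)
  have \<Omega>_eq: "\<Omega> = \<phi> ` V" using bij by (simp add: \<Omega>_def bij_betw_def)
  note closed = transformation_group_closed[OF tg]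
  have conj\<phi>: "conj h (\<phi> x) = \<phi> (h x)" if "x \<in> V" for h x
    using that by (simp add: conj_def \<phi>_mem \<psi>\<phi>)
  have conj_mem: "conj h k \<in> \<Omega>" if "h \<in> A" "k \<in> \<Omega>" for h k
    using that by (simp add: conj_def \<phi>_mem \<psi>_mem closed)
  have conj_cong: "conj g = conj h" if "\<And>x. x \<in> V \<Longrightarrow> g x = h x" for g h
    unfolding conj_def by (rule restrict_ext) (simp add: that \<psi>_mem)
  have conj_comp: "compose \<Omega> (conj g) (conj h) = conj (\<lambda>x. g (h x))" if "g \<in> A" "h \<in> A" for g h
    using that by (auto simp: fun_eq_iff compose_def conj_def \<phi>_mem \<psi>_mem closed \<psi>\<phi>)
  have conj_id: "conj (\<lambda>x. x) = (\<lambda>x\<in>\<Omega>. x)"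
    unfolding conj_def by (rule restrict_ext) (simp add: \<phi>\<psi>)
  have conj_Bij: "conj h \<in> Bij \<Omega>" if "h \<in> A" for h
  proof -
    obtain k where k: "k \<in> A" "\<And>x. x \<in> V \<Longrightarrow> k (h x) = x"
      using transformation_group_inv[OF tg \<open>h \<in> A\<close>] by blast
    have "inj_on (conj h) \<Omega>"
      by (rule inj_on_inverseI[of _ "conj k"])
         (use that k in \<open>auto simp: \<Omega>_eq conj\<phi> closed\<close>)
    moreover have "conj h ` \<Omega> \<subseteq> \<Omega>" using conj_mem that by blast
    ultimately have "bij_betw (conj h) \<Omega> \<Omega>"
      by (simp add: bij_betw_def endo_inj_surj \<Omega>_def)
    then show ?thesis by (simp add: Bij_def conj_def)
  qed
  have sub: "subgroup G (BijGroup \<Omega>)"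
  proof
    show "G \<subseteq> carrier (BijGroup \<Omega>)" using conj_Bij by (auto simp: G_def BijGroup_def)
  next
    fix x y assume "x \<in> G" "y \<in> G"
    then obtain g h where gh: "g \<in> A" "h \<in> A" "x = conj g" "y = conj h" by (auto simp: G_def)
    obtain k where "k \<in> A" "\<And>x. x \<in> V \<Longrightarrow> k x = g (h x)"
      using transformation_group_comp[OF tg gh(1,2)] by blast
    then have "compose \<Omega> x y = conj k" using gh conj_comp conj_cong by metis
    then show "x \<otimes>\<^bsub>BijGroup \<Omega>\<^esub> y \<in> G"
      using gh conj_Bij \<open>k \<in> A\<close> by (simp add: BijGroup_def G_def)
  next
    obtain h where "h \<in> A" "\<And>x. x \<in> V \<Longrightarrow> h x = x" using transformation_group_id[OF tg] by blast
    then have "conj h = \<one>\<^bsub>BijGroup \<Omega>\<^esub>" using conj_id conj_cong[of h "\<lambda>x. x"] by (simp add: BijGroup_def)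
    then show "\<one>\<^bsub>BijGroup \<Omega>\<^esub> \<in> G" using \<open>h \<in> A\<close> unfolding G_def by (metis imageI)
  next
    fix x assume "x \<in> G"
    then obtain h where h: "h \<in> A" "x = conj h" by (auto simp: G_def)
    obtain k where k: "k \<in> A" "\<And>x. x \<in> V \<Longrightarrow> k (h x) = x"
      using transformation_group_inv[OF tg h(1)] by blast
    have "compose \<Omega> (conj k) (conj h) = (\<lambda>x\<in>\<Omega>. x)"
      using conj_comp[OF k(1) h(1)] conj_id conj_cong k(2) by metis
    then have "inv\<^bsub>BijGroup \<Omega>\<^esub> x = conj k"
      using h k conj_Bij by (intro group.inv_equality[OF group_BijGroup]) (simp_all add: BijGroup_def)
    then show "inv\<^bsub>BijGroup \<Omega>\<^esub> x \<in> G" using k by (simp add: G_def)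
  qed
  have "transitive_action (BijGroup \<Omega>\<lparr>carrier := G\<rparr>) \<Omega> (\<lambda>g. g)"
  proof -
    have "\<exists>g\<in>G. g x = y" if xy: "x \<in> \<Omega>" "y \<in> \<Omega>" for x y
    proof -
      obtain g where "g \<in> A" "g (\<psi> x) = \<psi> y" using trans xy \<psi>_mem by blast
      then show ?thesis using xy by (intro bexI[of _ "conj g"]) (auto simp: conj_def \<phi>\<psi> G_def)
    qed
    moreover have "(\<lambda>g. g) \<in> hom (BijGroup \<Omega>\<lparr>carrier := G\<rparr>) (BijGroup \<Omega>)"
      using subgroup.subset[OF sub] by (auto simp: hom_def)
    ultimately show ?thesis
      using subgroup.subgroup_is_group[OF sub group_BijGroup] group_BijGroup
      by (simp add: transitive_action_def transitive_action_axioms_def group_action_def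
          group_hom_def group_hom_axioms_def)
  qed
  moreover have "is_singleton B \<or> B = \<Omega>" if "is_block G \<Omega> B" for B
  proof -
    have B: "B \<subseteq> \<Omega>" "B \<noteq> {}" "\<And>g. g \<in> A \<Longrightarrow> conj g ` B = B \<or> conj g ` B \<inter> B = {}"
      using that by (auto simp: is_block_def G_def)
    have B_eq: "B = \<phi> ` \<psi> ` B" using B(1) \<phi>\<psi> by (force simp: image_iff)
    have sub: "\<psi> ` B \<subseteq> V" using B(1) \<psi>_mem by blast
    have "g ` \<psi> ` B = \<psi> ` B \<or> g ` \<psi> ` B \<inter> \<psi> ` B = {}" if g: "g \<in> A" for g
    proof -
      have *: "g ` \<psi> ` B = \<psi> ` conj g ` B"
        using B(1) g by (force simp: image_image conj_def \<psi>\<phi> \<psi>_mem closed intro: image_cong)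
      have "\<psi> ` conj g ` B \<inter> \<psi> ` B = \<psi> ` (conj g ` B \<inter> B)"
        by (rule inj_on_image_Int[of _ \<Omega>, symmetric])
           (use B(1) g \<phi>\<psi> conj_mem in \<open>auto intro!: inj_on_inverseI[of _ \<phi>]\<close>)
      with * B(3)[OF g] show ?thesis by auto
    qed
    then have "is_singleton (\<psi> ` B) \<or> \<psi> ` B = V" using prim[OF sub] B(2) by blast
    then show ?thesis
      using B_eq \<Omega>_eq by (metis image_insert image_empty is_singleton_def)
  qed
  moreover have "irredundant_base_sizes G \<Omega> = length ` {vs. irredundant_on V A vs}"
  proof -
    have eq: "irredundant_on \<Omega> G (map \<phi> vs) \<longleftrightarrow> irredundant_on V A vs" if "set vs \<subseteq> V" for vs
    proof -
      have inj: "\<phi> x = \<phi> y \<longleftrightarrow> x = y" if "x \<in> V" "y \<in> V" for x y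
        using \<psi>\<phi> that by metis
      have nth: "vs ! i \<in> V" if "i < length vs" for i using that \<open>set vs \<subseteq> V\<close> by auto
      have fix_iff: "conj h (\<phi> x) = \<phi> x \<longleftrightarrow> h x = x" if "h \<in> A" "x \<in> V" for h x
        using that by (simp add: conj\<phi> inj closed)
      have "set (map \<phi> vs) \<subseteq> \<Omega>" using \<open>set vs \<subseteq> V\<close> \<phi>_mem by auto
      moreover have "(\<exists>h\<in>G. (\<forall>j<i. h (map \<phi> vs ! j) = map \<phi> vs ! j) \<and> h (map \<phi> vs ! i) \<noteq> map \<phi> vs ! i)
        \<longleftrightarrow> (\<exists>h\<in>A. (\<forall>j<i. h (vs ! j) = vs ! j) \<and> h (vs ! i) \<noteq> vs ! i)" if "i < length vs" for i
        using that nth by (auto simp: G_def fix_iff)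
      moreover have "(\<forall>h\<in>G. (\<forall>v\<in>set (map \<phi> vs). h v = v) \<longrightarrow> (\<forall>x\<in>\<Omega>. h x = x))
        \<longleftrightarrow> (\<forall>h\<in>A. (\<forall>v\<in>set vs. h v = v) \<longrightarrow> (\<forall>x\<in>V. h x = x))"
        using \<open>set vs \<subseteq> V\<close> by (auto simp: G_def \<Omega>_eq fix_iff subset_eq)
      ultimately show ?thesis using \<open>set vs \<subseteq> V\<close> unfolding irredundant_on_def by simp
    qed
    have "ws = map \<phi> (map \<psi> ws)" "set (map \<psi> ws) \<subseteq> V" if "set ws \<subseteq> \<Omega>" for ws
      using that \<phi>\<psi> \<psi>_mem by (auto simp: map_idI subset_eq)
    then have "length ws \<in> length ` {vs. irredundant_on V A vs}" if "irredundant_on \<Omega> G ws" for ws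
      using that eq[of "map \<psi> ws"]
      by (metis (mono_tags, lifting) imageI irredundant_on_def length_map mem_Collect_eq)
    moreover have "irredundant_on \<Omega> G (map \<phi> vs)" if "irredundant_on V A vs" for vs
      using that eq by (simp add: irredundant_on_def)
    ultimately show ?thesis
      unfolding irredundant_base_sizes_def irredundant_base_iff[OF sub]
      by (auto simp: image_iff) (metis length_map)
  qed
  ultimately have "primitive_permutation_group G \<Omega> \<and>
      irredundant_base_sizes G \<Omega> = length ` {vs. irredundant_on V A vs}"
    using ne sub unfolding primitive_permutation_group_def permutation_group_def
    by (auto simp: \<Omega>_eq fin)
  then show ?thesis by blast
qed

text \<open>Translations give transitivity. A block moved so as to contain 0 is closed under
  addition and under \<open>H\<close>, hence trivial by irreducibility. A point stabilizer is
  conjugate to \<open>H\<close> by a translation, and the first point of a base accounts for the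
  \<open>Suc\<close>.\<close>

lemma exists_primitive_affine_group:
  fixes V :: "'v :: ab_group_add set"
  assumes fin: "finite V" and zero: "0 \<in> V" and nz: "u \<in> V" "u \<noteq> 0"
    and add: "\<And>x y. x \<in> V \<Longrightarrow> y \<in> V \<Longrightarrow> x + y \<in> V"
    and neg: "\<And>x. x \<in> V \<Longrightarrow> - x \<in> V"
    and tg: "transformation_group V H"
    and additive: "\<And>h x y. h \<in> H \<Longrightarrow> x \<in> V \<Longrightarrow> y \<in> V \<Longrightarrow> h (x + y) = h x + h y"
    and irred: "\<And>U. U \<subseteq> V \<Longrightarrow> 0 \<in> U \<Longrightarrow> (\<And>x y. x \<in> U \<Longrightarrow> y \<in> U \<Longrightarrow> x + y \<in> U) \<Longrightarrow>
       (\<And>h x. h \<in> H \<Longrightarrow> x \<in> U \<Longrightarrow> h x \<in> U) \<Longrightarrow> U = {0} \<or> U = V"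
  shows "\<exists>(\<Omega> :: nat set) G. primitive_permutation_group G \<Omega> \<and>
           irredundant_base_sizes G \<Omega> = (\<lambda>vs. Suc (length vs)) ` {vs. irredundant_on V H vs}"
proof -
  define A where "A = (\<lambda>(h, t) x. h x + t) ` (H \<times> V)"
  have A_iff: "f \<in> A \<longleftrightarrow> (\<exists>h\<in>H. \<exists>t\<in>V. f = (\<lambda>x. h x + t))" for f
    by (auto simp: A_def)
  have AI: "(\<lambda>x. h x + t) \<in> A" if "h \<in> H" "t \<in> V" for h t using that A_iff by blast
  have diff: "x - y \<in> V" if "x \<in> V" "y \<in> V" for x y
    using add[OF that(1) neg[OF that(2)]] by simp
  note closed = transformation_group_closed[OF tg]
  obtain i where i: "i \<in> H" "\<And>x. x \<in> V \<Longrightarrow> i x = x"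
    using transformation_group_id[OF tg] by blast
  have tgA: "transformation_group V A"
    unfolding transformation_group_def
  proof (intro conjI ballI)
    fix f x assume "f \<in> A" "x \<in> V" then show "f x \<in> V" by (auto simp: A_iff add closed)
  next
    show "\<exists>h\<in>A. \<forall>x\<in>V. h x = x" using AI[OF i(1) zero] i(2) by (intro bexI[of _ "\<lambda>x. i x + 0"]) auto
  next
    fix f1 f2 assume "f1 \<in> A" "f2 \<in> A"
    then obtain g s h t where f: "g \<in> H" "s \<in> V" "h \<in> H" "t \<in> V"
      "f1 = (\<lambda>x. g x + s)" "f2 = (\<lambda>x. h x + t)"
      by (auto simp: A_iff)
    obtain k where k: "k \<in> H" "\<And>x. x \<in> V \<Longrightarrow> k x = g (h x)"
      using transformation_group_comp[OF tg f(1,3)] by blast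
    have "(\<lambda>x. k x + (g t + s)) \<in> A" using k f by (intro AI) (auto simp: add closed)
    then show "\<exists>k\<in>A. \<forall>x\<in>V. k x = f1 (f2 x)"
      by (rule bexI[rotated]) (use k f in \<open>auto simp: additive closed add_ac\<close>)
  next
    fix f assume "f \<in> A"
    then obtain h t where f: "h \<in> H" "t \<in> V" "f = (\<lambda>x. h x + t)" by (auto simp: A_iff)
    obtain k where k: "k \<in> H" "\<And>x. x \<in> V \<Longrightarrow> k (h x) = x"
      using transformation_group_inv[OF tg f(1)] by blast
    have "(\<lambda>x. k x + - k t) \<in> A" using k f by (intro AI) (auto simp: neg closed)
    then show "\<exists>k\<in>A. \<forall>x\<in>V. k (f x) = x"
      by (rule bexI[rotated]) (use k f in \<open>auto simp: additive closed add_ac\<close>)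
  qed
  have translation: "(\<lambda>x. i x + t) \<in> A" if "t \<in> V" for t using AI i that by blast
  have "\<exists>(\<Omega> :: nat set) G. primitive_permutation_group G \<Omega> \<and>
           irredundant_base_sizes G \<Omega> = length ` {vs. irredundant_on V A vs}"
  proof (rule exists_primitive_nat_copy[OF fin _ tgA])
    show "V \<noteq> {}" using zero by blast
  next
    fix x y assume "x \<in> V" "y \<in> V"
    then show "\<exists>g\<in>A. g x = y"
      using translation[OF diff[of y x]] i(2) by (intro bexI) auto
  next
    fix B assume B: "B \<subseteq> V" "B \<noteq> {}" "\<forall>g\<in>A. g ` B = B \<or> g ` B \<inter> B = {}"
    then obtain x0 where x0: "x0 \<in> B" by blast
    then have x0V: "x0 \<in> V" using B by blast
    have block: "g ` B = B" if "g \<in> A" "x \<in> B" "g x \<in> B" for g x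
      using B(3) that by blast
    define U where "U = (\<lambda>b. b - x0) ` B"
    have U_iff: "y \<in> U \<longleftrightarrow> y + x0 \<in> B" for y
      unfolding U_def by (force simp: image_iff)
    have "U = {0} \<or> U = V"
    proof (rule irred)
      show "U \<subseteq> V" using B(1) x0V diff by (auto simp: U_def)
      show "0 \<in> U" using x0 by (simp add: U_iff)
    next
      fix x y assume xy: "x \<in> U" "y \<in> U"
      then have V: "x \<in> V" "y + x0 \<in> V" using B(1) x0V diff by (auto simp: U_def)
      \<comment> \<open>Translation by \<open>x\<close> sends \<open>x0\<close> to the point
        \<open>x + x0\<close> of \<open>B\<close>, so it preserves \<open>B\<close>.\<close>
      have "(\<lambda>z. i z + x) ` B = B"
        by (rule block[OF translation x0]) (use V xy x0V i in \<open>auto simp: U_iff add_ac\<close>)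
      then have "i (y + x0) + x \<in> B" using xy(2) U_iff by blast
      then show "x + y \<in> U" using V i by (simp add: U_iff add_ac)
    next
      fix h x assume h: "h \<in> H" and x: "x \<in> U"
      then have V: "x \<in> V" using B(1) x0V diff by (auto simp: U_def)
      \<comment> \<open>This map fixes \<open>x0\<close>, so it preserves \<open>B\<close>; with
        \<open>x0\<close> as origin it is \<open>h\<close>.\<close>
      have "(\<lambda>z. h z + (x0 - h x0)) ` B = B"
        by (rule block[OF AI x0]) (use h x0V x0 closed diff in auto)
      moreover have "x + x0 \<in> B" using x U_iff by blast
      ultimately have "h (x + x0) + (x0 - h x0) \<in> B" by blast
      then show "h x \<in> U" using h V x0V by (simp add: additive U_iff)
    qed
    moreover have B_eq: "B = (\<lambda>y. y + x0) ` U" by (auto simp: U_def image_image)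
    moreover have "(\<lambda>y. y + x0) ` V = V"
      using add diff x0V by (force simp: image_iff intro: bexI[of _ "_ - x0"])
    ultimately show "is_singleton B \<or> B = V" by (metis image_insert image_empty is_singleton_def)
  qed
  moreover have "length ` {vs. irredundant_on V A vs} = (\<lambda>vs. Suc (length vs)) ` {vs. irredundant_on V H vs}"
  proof -
    have "\<exists>h\<in>A. \<exists>x\<in>V. h x \<noteq> x"
      using translation[OF nz(1)] i(2)[OF zero] zero nz
      by (intro bexI[of _ "\<lambda>x. i x + u"] bexI[of _ 0]) auto
    then have nonempty: "\<not> irredundant_on V A []" by (auto simp: irredundant_on_def)
    have eq: "irredundant_on V A (w # map (\<lambda>v. v + w) vs) \<longleftrightarrow> irredundant_on V H vs"
      if w: "w \<in> V" and vs: "set vs \<subseteq> V" for w vs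
    proof -
      have nth: "vs ! j \<in> V" if "j < length vs" for j using that vs by auto
      \<comment> \<open>The stabilizer of \<open>w\<close> is \<open>H\<close> conjugated by the
        translation by \<open>w\<close>.\<close>
      have point: "f \<in> A \<and> f w = w \<longleftrightarrow> (\<exists>h\<in>H. f = (\<lambda>x. h x + (w - h w)))" for f
      proof
        assume "f \<in> A \<and> f w = w"
        then obtain h t where "h \<in> H" "f = (\<lambda>x. h x + t)" "h w + t = w" by (auto simp: A_iff)
        then show "\<exists>h\<in>H. f = (\<lambda>x. h x + (w - h w))"
          by (intro bexI[of _ h]) (auto simp: algebra_simps)
      next
        assume "\<exists>h\<in>H. f = (\<lambda>x. h x + (w - h w))"
        then show "f \<in> A \<and> f w = w" using w closed diff AI by auto
      qed
      have ex_bex: "(\<exists>f. (\<exists>h\<in>H. f = (\<lambda>x. h x + (w - h w))) \<and> P f) \<longleftrightarrow>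
          (\<exists>h\<in>H. P (\<lambda>x. h x + (w - h w)))" for P
        by blast
      have fix_iff: "h (v + w) + (w - h w) = v + w \<longleftrightarrow> h v = v" if "h \<in> H" "v \<in> V" for h v
        using additive[OF that w] by (simp add: algebra_simps)
      have "set (w # map (\<lambda>v. v + w) vs) \<subseteq> V" using w vs add by auto
      moreover have "(\<forall>i<length (w # map (\<lambda>v. v + w) vs). \<exists>h\<in>A.
            (\<forall>j<i. h ((w # map (\<lambda>v. v + w) vs) ! j) = (w # map (\<lambda>v. v + w) vs) ! j) \<and>
            h ((w # map (\<lambda>v. v + w) vs) ! i) \<noteq> (w # map (\<lambda>v. v + w) vs) ! i)
        \<longleftrightarrow> (\<forall>i<length vs. \<exists>h\<in>H. (\<forall>j<i. h (vs ! j) = vs ! j) \<and> h (vs ! i) \<noteq> vs ! i)"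
        (is "(\<forall>i<_. ?P i) \<longleftrightarrow> (\<forall>i<_. ?Q i)")
      proof -
        \<comment> \<open>Translation by the nonzero vector \<open>u\<close> moves \<open>w\<close>,
          so the first point is always a strict step.\<close>
        have "?P 0"
          using translation[OF nz(1)] nz w i(2)[OF w] by (intro bexI) auto
        moreover have "?P (Suc i) \<longleftrightarrow> ?Q i" if "i < length vs" for i
        proof -
          have "?P (Suc i) \<longleftrightarrow> (\<exists>f. (f \<in> A \<and> f w = w) \<and>
              (\<forall>j<i. f (vs ! j + w) = vs ! j + w) \<and> f (vs ! i + w) \<noteq> vs ! i + w)"
            using that by (auto simp: All_less_Suc2)
          also have "\<dots> \<longleftrightarrow> (\<exists>h\<in>H. (\<forall>j<i. h (vs ! j + w) + (w - h w) = vs ! j + w) \<and>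
              h (vs ! i + w) + (w - h w) \<noteq> vs ! i + w)"
            unfolding point by (rule ex_bex)
          also have "\<dots> \<longleftrightarrow> ?Q i"
            using that nth by (intro bex_cong refl) (simp add: fix_iff)
          finally show ?thesis .
        qed
        ultimately show ?thesis by (simp add: All_less_Suc2)
      qed
      moreover have "(\<forall>f\<in>A. (\<forall>v\<in>set (w # map (\<lambda>v. v + w) vs). f v = v) \<longrightarrow> (\<forall>x\<in>V. f x = x))
        \<longleftrightarrow> (\<forall>h\<in>H. (\<forall>v\<in>set vs. h v = v) \<longrightarrow> (\<forall>x\<in>V. h x = x))"
      proof -
        have shift: "(\<forall>x\<in>V. P x) \<longleftrightarrow> (\<forall>x\<in>V. P (x + w))" for P
          using add[OF _ w] diff[OF _ w] by (metis diff_add_cancel)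
        have "(\<forall>f\<in>A. (\<forall>v\<in>set (w # map (\<lambda>v. v + w) vs). f v = v) \<longrightarrow> (\<forall>x\<in>V. f x = x))
          \<longleftrightarrow> (\<forall>f. (f \<in> A \<and> f w = w) \<longrightarrow> (\<forall>v\<in>set vs. f (v + w) = v + w) \<longrightarrow> (\<forall>x\<in>V. f (x + w) = x + w))"
          using shift[of "\<lambda>x. _ x = x"] by auto
        also have "\<dots> \<longleftrightarrow> (\<forall>h\<in>H. (\<forall>v\<in>set vs. h v = v) \<longrightarrow> (\<forall>x\<in>V. h x = x))"
          unfolding point using vs by (auto simp: fix_iff subset_eq)
        finally show ?thesis .
      qed
      ultimately show ?thesis using vs unfolding irredundant_on_def by blast
    qed
    have "length ws \<in> (\<lambda>vs. Suc (length vs)) ` {vs. irredundant_on V H vs}"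
      if ws: "irredundant_on V A ws" for ws
    proof (cases ws)
      case Nil with ws nonempty show ?thesis by simp
    next
      case (Cons w us)
      then have w: "w \<in> V" "set us \<subseteq> V" using ws by (auto simp: irredundant_on_def)
      define vs where "vs = map (\<lambda>v. v - w) us"
      have "us = map (\<lambda>v. v + w) vs" by (simp add: vs_def map_idI)
      moreover have "set vs \<subseteq> V" using w diff by (auto simp: vs_def)
      ultimately have "irredundant_on V H vs" using eq[of w vs] ws Cons w by metis
      then show ?thesis using Cons by (intro image_eqI[of _ _ vs]) (auto simp: vs_def)
    qed
    moreover have "irredundant_on V A (0 # map (\<lambda>v. v + 0) vs)" if "irredundant_on V H vs" for vs
      using that eq[OF zero] by (simp add: irredundant_on_def)
    ultimately show ?thesis
      by (auto simp: image_iff) (metis length_Cons length_map)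
  qed
  ultimately show ?thesis by simp
qed

section \<open>Finite fields\<close>

text \<open>The characteristic \<open>5\<close> is the least one in which \<open>2\<close> differs from \<open>0\<close>, \<open>1\<close> and \<open>-1\<close>.\<close>

typedef gf5 = "UNIV :: 5 set" by simp

setup_lifting type_definition_gf5

instantiation gf5 :: comm_ring_1
begin
lift_definition zero_gf5 :: gf5 is 0 .
lift_definition one_gf5 :: gf5 is 1 .
lift_definition plus_gf5 :: "gf5 \<Rightarrow> gf5 \<Rightarrow> gf5" is "(+)" .
lift_definition minus_gf5 :: "gf5 \<Rightarrow> gf5 \<Rightarrow> gf5" is "(-)" .
lift_definition uminus_gf5 :: "gf5 \<Rightarrow> gf5" is uminus .
lift_definition times_gf5 :: "gf5 \<Rightarrow> gf5 \<Rightarrow> gf5" is "(*)" .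
instance by standard (transfer; simp add: algebra_simps)+
end

instantiation gf5 :: field
begin
text \<open>Nonzero residues modulo 5 satisfy x^4 = 1, so the cube is the inverse; at 0 it takes the
  required value 0.\<close>

definition inverse_gf5 :: "gf5 \<Rightarrow> gf5" where "inverse_gf5 x = x ^ 3"
definition divide_gf5 :: "gf5 \<Rightarrow> gf5 \<Rightarrow> gf5" where "divide_gf5 x y = x * inverse y"
instance
proof
  have UNIV5: "UNIV = {0, 1, 2, 3, 4 :: 5}" 
    by (rule sym, rule card_subset_eq) auto
  have *: "x * x * x * x = 1" if "x \<noteq> 0" for x :: 5
    using that UNIV5 by auto
  have "x * x * x * x = 1" if "x \<noteq> 0" for x :: gf5
    using that by transfer (rule *)
  then show "inverse x * x = 1" if "x \<noteq> 0" for x :: gf5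
    using that by (simp add: inverse_gf5_def power3_eq_cube)
qed (auto simp: inverse_gf5_def divide_gf5_def)
end

lemma CHAR_gf5: "CHAR(gf5) = 5"
proof -
  have of_nat: "of_nat k = Abs_gf5 (of_nat k)" for k
    by (induction k) (simp_all add: zero_gf5_def plus_gf5.abs_eq one_gf5_def eq_onp_def)
  have z: "of_nat k = (0 :: gf5) \<longleftrightarrow> of_nat k = (0 :: 5)" for k
    by (simp add: of_nat zero_gf5_def Abs_gf5_inject)
  show ?thesis
  proof (rule CHAR_eq_posI)
    show "of_nat 5 = (0 :: gf5)" unfolding z by simp
    fix k :: nat assume "k > 0" "k < 5"
    then have "k \<in> {1, 2, 3, 4}" by auto
    then show "of_nat k \<noteq> (0 :: gf5)" unfolding z by auto
  qed simp
qed

text \<open>The fixed points are the roots of X^q - X, where q is the given power of the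
  characteristic. This polynomial splits, and its derivative is the constant -1, so it has q
  distinct roots.\<close>

lemma card_frobenius_fixed_field:
  fixes dummy :: "'a :: alg_closed_field"
  assumes "prime CHAR('a)" "k > 0"
  shows "card {x :: 'a. x ^ (CHAR('a) ^ k) = x} = CHAR('a) ^ k"
proof -
  define q where "q = CHAR('a) ^ k"
  have q: "q > 1"
    unfolding q_def using assms prime_gt_1_nat one_less_power by blast
  define P :: "'a poly" where "P = monom 1 q - monom 1 1"
  have deg: "degree P = q"
    unfolding P_def diff_conv_add_uminus using q
    by (subst degree_add_eq_left) (auto simp: degree_monom_eq)
  have P0: "P \<noteq> 0" using deg q by auto
  have root: "poly P x = 0 \<longleftrightarrow> x ^ q = x" for x by (simp add: P_def poly_monom)
  have "(of_nat q :: 'a) = 0" using assms(2) by (simp add: q_def of_nat_power power_0_left)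
  then have pd: "poly (pderiv P) x = - 1" for x
    by (simp add: P_def pderiv_diff pderiv_monom poly_monom)
  obtain A where A: "size A = degree P" "P = smult (lead_coeff P) (\<Prod>x\<in>#A. [:-x, 1:])"
    using alg_closed_imp_factorization[OF P0] by blast
  have "poly P x = 0 \<longleftrightarrow> x \<in># A" for x
    using P0 by (subst A(2)) (auto simp: poly_prod_mset prod_mset_zero_iff)
  then have set_A: "set_mset A = {x. x ^ q = x}" using root by auto
  \<comment> \<open>A root occurring twice would also be a root of the derivative.\<close>
  have "count A a \<le> 1" for a
  proof (rule ccontr)
    assume "\<not> count A a \<le> 1"
    then have "{#a, a#} \<subseteq># A" by (simp add: subseteq_mset_def)
    then obtain B where B: "A = {#a, a#} + B" by (auto simp: mset_subset_eq_exists_conv)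
    have split: "(\<Prod>x\<in>#A. f x) = f a * (f a * (\<Prod>x\<in>#B. f x))" for f :: "'a \<Rightarrow> 'a poly"
      by (simp add: B mult.assoc)
    have "P = [:-a, 1:] * ([:-a, 1:] * smult (lead_coeff P) (\<Prod>x\<in>#B. [:-x, 1:]))"
      by (subst A(2)) (simp only: split mult_smult_right)
    moreover have "poly (pderiv (L * (L * R))) a = 0" if "poly L a = 0" for L R
      by (simp add: pderiv_mult that)
    moreover have "poly [:-a, 1:] a = 0" by simp
    ultimately have "poly (pderiv P) a = 0" by metis
    then show False by (simp add: pd)
  qed
  then have "size A = card (set_mset A)"
    unfolding size_multiset_overloaded_eq
    by (subst sum.cong[OF refl, of _ _ "\<lambda>_. 1"]) (auto simp: le_antisym Suc_leI)
  then show ?thesis using A(1) deg set_A by (simp add: q_def)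
qed

text \<open>The \<open>e\<close>-th iterate of the Frobenius map: field automorphisms are named by
  natural exponents.\<close>

definition frob :: "nat \<Rightarrow> 'a :: field \<Rightarrow> 'a" where
  "frob e c = c ^ (CHAR('a) ^ e)"

definition scale :: "'a :: times \<Rightarrow> ('i \<Rightarrow> 'a) \<Rightarrow> 'i \<Rightarrow> 'a" where
  "scale c x = (\<lambda>i. c * x i)"

lemma scale_apply [simp]: "scale c x i = c * x i"
  by (simp add: scale_def)

text \<open>Such a set is the preimage of a subgroup of the cyclic group of order
  \<open>2 ^ m\<close>, and each of these subgroups is generated by a power of two.\<close>

lemma multiples_of_power_of_two:
  fixes T :: "nat set"
  assumes add: "\<And>a b. a \<in> T \<Longrightarrow> b \<in> T \<Longrightarrow> a + b \<in> T"
    and period: "\<And>e. e + 2 ^ m \<in> T \<Longrightarrow> e \<in> T" and "2 ^ m \<in> T"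
  shows "\<exists>r\<le>m. T = {e. 2 ^ r dvd e}"
proof -
  have zero: "0 \<in> T" using period[of 0] assms(3) by simp
  have mult: "e * k \<in> T" if "e \<in> T" for e k
    by (induction k) (use zero that add in auto)
  have period': "e \<in> T" if "2 ^ m * k + e \<in> T" for e k
    using that
  proof (induction k)
    case (Suc k)
    then have "2 ^ m * k + e + 2 ^ m \<in> T" by (simp add: algebra_simps)
    then show ?case by (rule Suc.IH[OF period])
  qed simp
  define r where "r = (LEAST s. 2 ^ s \<in> T)"
  have r: "2 ^ r \<in> T" unfolding r_def by (rule LeastI[of "\<lambda>s. 2 ^ s \<in> T", OF assms(3)])
  have least: "r \<le> s" if "2 ^ s \<in> T" for s unfolding r_def by (rule Least_le[of "\<lambda>s. 2 ^ s \<in> T", OF that])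
  have "2 ^ r dvd e" if "e \<in> T" for e
  proof (cases "e = 0")
    case False
    \<comment> \<open>Removing the multiple of the period puts the gcd of \<open>e\<close> and
      \<open>2 ^ m\<close> into \<open>T\<close>. It is a power of two, hence a multiple of the
      least one, \<open>2 ^ r\<close>.\<close>
    then obtain x y where "e * x = 2 ^ m * y + gcd e (2 ^ m)" using bezout_nat by blast
    then have "gcd e (2 ^ m) \<in> T" using mult[OF that] period' by metis
    moreover obtain s where "gcd e (2 ^ m) = 2 ^ s"
      using divides_primepow_nat[of 2 "gcd e (2 ^ m)" m] by auto
    ultimately have "2 ^ r dvd gcd e (2 ^ m)" using least by (simp add: le_imp_power_dvd)
    then show ?thesis by simp
  qed simp
  moreover have "e \<in> T" if "2 ^ r dvd e" for e
    using that mult[OF r] by (auto simp: dvd_def)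
  ultimately show ?thesis using least[OF assms(3)] by blast
qed

lemma mod_add_right_cancel_nat:
  fixes i j k n :: nat
  assumes "(i + k) mod n = (j + k) mod n" "i < n" "j < n"
  shows "i = j"
  using assms
proof (induction i j rule: linorder_wlog)
  case (le i j)
  then have "n dvd j + k - (i + k)" by (subst mod_eq_dvd_iff_nat[symmetric]) simp_all
  then show ?case using le by (auto dest: dvd_imp_le)
qed metis

section \<open>Semilinear maps\<close>

text \<open>\<open>F\<close> is the subfield of order \<open>CHAR('a) ^ 2 ^ m\<close>, cut out of an
  algebraically closed field as a fixed field. Vectors vanish from index \<open>n\<close> on, so
  equality of vectors is equality of functions.\<close>

locale frobenius_space =
  fixes m n :: nat and F :: "'a :: alg_closed_field set" and V :: "(nat \<Rightarrow> 'a) set"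
  assumes prime_char: "prime CHAR('a)"
    and F_def: "F = {c. frob (2 ^ m) c = c}"
    and V_def: "V = {x. (\<forall>i<n. x i \<in> F) \<and> (\<forall>i\<ge>n. x i = 0)}"
begin

section \<open>Frobenius powers, the field \<open>F\<close> and the space \<open>V\<close>\<close>

lemma char_pos: "CHAR('a) > 0"
  using prime_char by (simp add: prime_gt_0_nat)

lemma frob_0 [simp]: "frob e (0 :: 'a) = 0"
  using char_pos by (simp add: frob_def)

lemma frob_1 [simp]: "frob e (1 :: 'a) = 1"
  by (simp add: frob_def)

lemma frob_id [simp]: "frob 0 (c :: 'a) = c"
  by (simp add: frob_def)

lemma frob_add: "frob e (a + b :: 'a) = frob e a + frob e b"
  unfolding frob_def by (rule freshmans_dream'[OF prime_char refl])

lemma frob_mult: "frob e (a * b :: 'a) = frob e a * frob e b"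
  by (simp add: frob_def power_mult_distrib)

lemma frob_inverse: "frob e (inverse a :: 'a) = inverse (frob e a)"
  by (simp add: frob_def power_inverse)

lemma frob_frob: "frob d (frob e (c :: 'a)) = frob (d + e) c"
  by (simp add: frob_def power_add mult.commute flip: power_mult)

lemma frob_minus: "frob e (- a :: 'a) = - frob e a"
  using minus_unique[of "frob e a" "frob e (- a)"] frob_add[of e a "- a"] by simp

lemma F_closed:
  shows F_0: "0 \<in> F" and F_1: "1 \<in> F"
    and F_add: "a \<in> F \<Longrightarrow> b \<in> F \<Longrightarrow> a + b \<in> F"
    and F_mult: "a \<in> F \<Longrightarrow> b \<in> F \<Longrightarrow> a * b \<in> F"
    and F_minus: "a \<in> F \<Longrightarrow> - a \<in> F"
    and F_inverse: "a \<in> F \<Longrightarrow> inverse a \<in> F"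
    and F_frob: "a \<in> F \<Longrightarrow> frob e a \<in> F"
  unfolding F_def by (auto simp: frob_add frob_mult frob_minus frob_inverse)
     (metis add.commute frob_frob)

lemma F_diff: "a \<in> F \<Longrightarrow> b \<in> F \<Longrightarrow> a - b \<in> F"
  using F_add[OF _ F_minus, of a b] by simp

lemma F_sum: "(\<And>i. i \<in> I \<Longrightarrow> f i \<in> F) \<Longrightarrow> sum f I \<in> F"
  by (induction I rule: infinite_finite_induct) (auto simp: F_0 F_add)

lemma frob_period: "c \<in> F \<Longrightarrow> frob (e + 2 ^ m) c = frob e c"
  unfolding F_def by (metis (mono_tags, lifting) frob_frob mem_Collect_eq)

lemma frob_period_mult: "c \<in> F \<Longrightarrow> frob (2 ^ m * k) c = c"
proof (induction k)
  case (Suc k)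
  then show ?case using frob_period[OF Suc.prems, of "2 ^ m * k"] by (simp add: add.commute)
qed simp

lemma card_F: "card F = CHAR('a) ^ 2 ^ m"
  unfolding F_def frob_def by (rule card_frobenius_fixed_field[OF prime_char]) simp

lemma card_F_gt_1: "card F > 1"
  unfolding card_F using prime_gt_1_nat[OF prime_char] by (rule one_less_power) simp

lemma finite_F: "finite F"
  using card_F_gt_1 by (metis card.infinite not_one_less_zero)

lemma V_iff: "x \<in> V \<longleftrightarrow> (\<forall>i<n. x i \<in> F) \<and> (\<forall>i\<ge>n. x i = 0)"
  by (simp add: V_def)

lemma V_in_F: "x \<in> V \<Longrightarrow> x i \<in> F"
  by (cases "i < n") (auto simp: V_iff F_0)

lemma V_0: "0 \<in> V" and V_add: "x \<in> V \<Longrightarrow> y \<in> V \<Longrightarrow> x + y \<in> V"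
  and V_minus: "x \<in> V \<Longrightarrow> - x \<in> V" and V_scale: "c \<in> F \<Longrightarrow> x \<in> V \<Longrightarrow> scale c x \<in> V"
  by (auto simp: V_iff F_closed)

lemma card_V: "card V = card F ^ n" and finite_V: "finite V"
proof -
  define ext where "ext f = (\<lambda>i. if i < n then f i else 0)" for f :: "nat \<Rightarrow> 'a"
  have "restrict (ext f) {..<n} = f" if "f \<in> {..<n} \<rightarrow>\<^sub>E F" for f
    using that by (auto simp: fun_eq_iff ext_def PiE_def extensional_def)
  moreover have "ext (restrict x {..<n}) = x" if "x \<in> V" for x
    using that by (auto simp: fun_eq_iff ext_def V_iff)
  moreover have "ext f \<in> V" if "f \<in> {..<n} \<rightarrow>\<^sub>E F" for f
    using that by (auto simp: ext_def V_iff)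
  moreover have "restrict x {..<n} \<in> {..<n} \<rightarrow>\<^sub>E F" if "x \<in> V" for x
    using V_in_F[OF that] by (simp add: restrict_PiE_iff)
  ultimately have "bij_betw ext ({..<n} \<rightarrow>\<^sub>E F) V"
    by (intro bij_betw_byWitness[where f' = "\<lambda>x. restrict x {..<n}"] ballI image_subsetI; blast)
  from bij_betw_same_card[OF this] bij_betw_finite[OF this]
  show "card V = card F ^ n" "finite V"
    by (auto simp: card_PiE finite_F intro: finite_PiE)
qed

text \<open>The exponent \<open>e\<close> names the automorphism that twists scalars, and only its
  residue modulo \<open>2 ^ m\<close> matters; type 0 means linear over \<open>F\<close>.\<close>

definition semilinear :: "nat \<Rightarrow> ((nat \<Rightarrow> 'a) \<Rightarrow> nat \<Rightarrow> 'a) \<Rightarrow> bool" where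
  "semilinear e h \<longleftrightarrow> (\<forall>x\<in>V. \<forall>y\<in>V. h (x + y) = h x + h y) \<and>
     (\<forall>c\<in>F. \<forall>x\<in>V. h (scale c x) = scale (frob e c) (h x))"

lemma semilinear_add: "semilinear e h \<Longrightarrow> x \<in> V \<Longrightarrow> y \<in> V \<Longrightarrow> h (x + y) = h x + h y"
  by (simp add: semilinear_def)

lemma semilinear_scale: "semilinear e h \<Longrightarrow> c \<in> F \<Longrightarrow> x \<in> V \<Longrightarrow> h (scale c x) = scale (frob e c) (h x)"
  by (simp add: semilinear_def)

lemma semilinear_period: "semilinear (e + 2 ^ m) h \<longleftrightarrow> semilinear e h"
  by (simp add: semilinear_def frob_period)

lemma semilinear_comp:
  assumes "semilinear d g" "semilinear e h" "\<And>x. x \<in> V \<Longrightarrow> h x \<in> V" "\<And>x. x \<in> V \<Longrightarrow> k x = g (h x)"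
  shows "semilinear (d + e) k"
  using assms by (simp add: semilinear_def V_add V_scale F_frob frob_frob)

text \<open>The field automorphisms induced by \<open>S\<close>, each with all exponents that name
  it.\<close>

definition types :: "((nat \<Rightarrow> 'a) \<Rightarrow> nat \<Rightarrow> 'a) set \<Rightarrow> nat set" where
  "types S = {e. \<exists>h\<in>S. semilinear e h}"

text \<open>Only elements of type 0 count, which makes this a subspace over \<open>F\<close>; the
  points fixed by properly semilinear maps need not form one.\<close>

definition linear_fixed :: "((nat \<Rightarrow> 'a) \<Rightarrow> nat \<Rightarrow> 'a) set \<Rightarrow> (nat \<Rightarrow> 'a) set" where
  "linear_fixed S = {x \<in> V. \<forall>h\<in>S. semilinear 0 h \<longrightarrow> h x = x}"

text \<open>Composition adds exponents, the identity has type 0, and exponents count modulo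
  \<open>2 ^ m\<close>, so the types come from a subgroup of a cyclic group of that order.\<close>

lemma types_eq_multiples:
  assumes "transformation_group V S"
  shows "\<exists>r\<le>m. types S = {e. 2 ^ r dvd e}"
proof (rule multiples_of_power_of_two)
  fix a b assume "a \<in> types S" "b \<in> types S"
  then obtain g h where gh: "g \<in> S" "semilinear a g" "h \<in> S" "semilinear b h"
    by (auto simp: types_def)
  obtain k where "k \<in> S" "\<forall>x\<in>V. k x = g (h x)"
    using transformation_group_comp[OF assms gh(1,3)] by blast
  moreover from this have "semilinear (a + b) k"
    using transformation_group_closed[OF assms gh(3)] by (intro semilinear_comp[OF gh(2,4)]) auto
  ultimately show "a + b \<in> types S" by (auto simp: types_def)
next
  show "e \<in> types S" if "e + 2 ^ m \<in> types S" for e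
    using that by (simp add: types_def semilinear_period)
  obtain i where "i \<in> S" "\<forall>x\<in>V. i x = x" using transformation_group_id[OF assms] by blast
  then have "semilinear 0 i" by (simp add: semilinear_def V_add V_scale)
  then show "2 ^ m \<in> types S"
    using \<open>i \<in> S\<close> semilinear_period[of 0 i] by (auto simp: types_def)
qed

lemma linear_fixed_sub: "linear_fixed S \<subseteq> V"
  by (auto simp: linear_fixed_def)

lemma linear_fixed_closed:
  "0 \<in> linear_fixed S"
  "x \<in> linear_fixed S \<Longrightarrow> y \<in> linear_fixed S \<Longrightarrow> x + y \<in> linear_fixed S"
  "c \<in> F \<Longrightarrow> x \<in> linear_fixed S \<Longrightarrow> scale c x \<in> linear_fixed S"
proof -
  show "0 \<in> linear_fixed S"
    unfolding linear_fixed_def using V_0 semilinear_add[of 0 _ 0 0] by fastforce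
qed (auto simp: linear_fixed_def V_add V_scale semilinear_add semilinear_scale[of 0])

text \<open>The vectors c v + u with c in \<open>F\<close> and u in \<open>U\<close> are distinct
  elements of \<open>W\<close>. Cardinalities thus take the place of dimensions.\<close>

lemma card_proper_subspace:
  assumes U: "U \<subseteq> V" "\<And>x y. x \<in> U \<Longrightarrow> y \<in> U \<Longrightarrow> x + y \<in> U"
      "\<And>c x. c \<in> F \<Longrightarrow> x \<in> U \<Longrightarrow> scale c x \<in> U"
    and W: "W \<subseteq> V" "\<And>x y. x \<in> W \<Longrightarrow> y \<in> W \<Longrightarrow> x + y \<in> W"
      "\<And>c x. c \<in> F \<Longrightarrow> x \<in> W \<Longrightarrow> scale c x \<in> W"
    and "U \<subseteq> W" "v \<in> W" "v \<notin> U"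
  shows "card F * card U \<le> card W"
proof -
  have diff: "x - y \<in> U" if "x \<in> U" "y \<in> U" for x y
  proof -
    have "scale (- 1) y = - y" by (simp add: fun_eq_iff)
    then show ?thesis using U(2)[OF that(1) U(3)[OF F_minus[OF F_1] that(2)]] by simp
  qed
  have "inj_on (\<lambda>(c, u). scale c v + u) (F \<times> U)"
  proof (rule inj_onI, clarify)
    fix c u c' u' assume F: "c \<in> F" "c' \<in> F" and u: "u \<in> U" "u' \<in> U"
      and eq: "scale c v + u = scale c' v + u'"
    have "c = c'"
    proof (rule ccontr)
      assume ne: "c \<noteq> c'"
      have "scale (c - c') v = u' - u"
        using eq by (auto simp: fun_eq_iff algebra_simps)
      then have "v = scale (inverse (c - c')) (u' - u)"
        using ne by (auto simp: fun_eq_iff field_simps)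
      then have "v \<in> U" using U(3)[OF F_inverse[OF F_diff[OF F]] diff[OF u(2,1)]] by simp
      with \<open>v \<notin> U\<close> show False ..
    qed
    with eq show "c = c' \<and> u = u'" by simp
  qed
  moreover have "(\<lambda>(c, u). scale c v + u) ` (F \<times> U) \<subseteq> W"
    using assms by auto
  moreover have "finite W" using W(1) finite_V finite_subset by blast
  ultimately have "card (F \<times> U) \<le> card W" by (rule card_inj_on_le)
  then show ?thesis by (simp add: card_cartesian_product)
qed

text \<open>Each point of an irredundant sequence enlarges the fixed space of the linear part of the stabilizer
  or shrinks the group of field automorphisms that the stabilizer induces.\<close>

lemma irredundant_length_le:
  assumes "transformation_group V S" "\<forall>h\<in>S. \<exists>e. semilinear e h"
    and "types S = {e. 2 ^ r dvd e}" "card F ^ k \<le> card (linear_fixed S)"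
    and "irredundant_on V S vs"
  shows "length vs + k + r \<le> n + m"
  using assms
proof (induction vs arbitrary: S k r)
  case Nil
  \<comment> \<open>The identity has type \<open>2 ^ m\<close> as well as 0, so the generator of the
    types divides \<open>2 ^ m\<close>.\<close>
  have "2 ^ r dvd (2 :: nat) ^ m"
    using types_eq_multiples[OF Nil.prems(1)] Nil.prems(3) le_imp_power_dvd by blast
  then have "r \<le> m" by (simp add: power_dvd_imp_le)
  moreover have "card F ^ k \<le> card F ^ n"
    using Nil.prems(4) card_mono[OF finite_V, of "linear_fixed S"]
    by (auto simp: linear_fixed_def card_V)
  then have "k \<le> n" using card_F_gt_1 by simp
  ultimately show ?case by simp
next
  case (Cons v vs)
  note tg = Cons.prems(1) and sl = Cons.prems(2)
  note irr = irredundant_on_Cons[OF Cons.prems(5)]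
  define S' where "S' = {h \<in> S. h v = v}"
  have sub: "S' \<subseteq> S" by (auto simp: S'_def)
  have tg': "transformation_group V S'"
    unfolding S'_def by (rule transformation_group_stabilizer[OF tg irr(1)])
  obtain r' where r': "types S' = {e. 2 ^ r' dvd e}" using types_eq_multiples[OF tg'] by blast
  have "types S' \<subseteq> types S" using sub by (auto simp: types_def)
  then have dvd: "2 ^ r dvd (2 :: nat) ^ r'" using r' Cons.prems(3) by auto
  then have "r \<le> r'" by (simp add: power_dvd_imp_le)
  have fixed_sub: "linear_fixed S \<subseteq> linear_fixed S'" using sub by (auto simp: linear_fixed_def)
  have fin: "finite (linear_fixed S')"
    using finite_V by (rule finite_subset[rotated]) (auto simp: linear_fixed_def)
  \<comment> \<open>\<open>k'\<close> stays open: it will be \<open>Suc k\<close> if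
    \<open>v\<close> is new to the linear fixed space, and otherwise \<open>k\<close>, in which case
    \<open>r'\<close> exceeds \<open>r\<close>.\<close>
  have IH: "length vs + k' + r' \<le> n + m" if "card F ^ k' \<le> card (linear_fixed S')" for k'
    using Cons.IH[OF tg' _ r' that] sl irr(3) by (auto simp: S'_def)
  show ?case
  proof (cases "v \<in> linear_fixed S")
    case False
    have "v \<in> linear_fixed S'" using irr(1) by (auto simp: linear_fixed_def S'_def)
    then have "card F * card (linear_fixed S) \<le> card (linear_fixed S')"
      using False fixed_sub linear_fixed_closed linear_fixed_sub
      by (intro card_proper_subspace[of "linear_fixed S" "linear_fixed S'" v]) simp_all
    with mult_le_mono2[OF Cons.prems(4)] have "card F ^ Suc k \<le> card (linear_fixed S')"
      unfolding power_Suc by (rule order_trans)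
    from IH[OF this] show ?thesis using \<open>r \<le> r'\<close> by simp
  next
    case True
    obtain h where h: "h \<in> S" "h v \<noteq> v" using irr(2) by blast
    obtain e where e: "semilinear e h" using sl h(1) by blast
    \<comment> \<open>Linear elements of \<open>S\<close> fix \<open>v\<close>. If some
      \<open>h'\<close> fixing \<open>v\<close> had the type of \<open>h\<close>, the inverse of
      \<open>h'\<close> composed with \<open>h\<close> would be linear, so it would fix
      \<open>v\<close>, and then \<open>h\<close> would fix \<open>v\<close> too.\<close>
    have "e \<notin> types S'"
    proof
      assume "e \<in> types S'"
      then obtain h' where h': "h' \<in> S'" "semilinear e h'" by (auto simp: types_def)
      then obtain k where k: "k \<in> S" "\<forall>x\<in>V. k (h' x) = x"
        using transformation_group_inv[OF tg] sub by blast
      obtain g where g: "g \<in> S" "\<forall>x\<in>V. g x = k (h x)"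
        using transformation_group_comp[OF tg k(1) h(1)] by blast
      note hV = transformation_group_closed[OF tg h(1)]
      have surj: "\<exists>x\<in>V. h' x = y" if "y \<in> V" for y
        using transformation_group_bij[OF tg' finite_V h'(1)] that unfolding bij_betw_def by (metis imageE)
      obtain d where d: "semilinear d k" using sl k(1) by blast
      \<comment> \<open>Instead of computing the type of \<open>k\<close>, \<open>h x\<close> is
        written as \<open>h' y\<close>; \<open>h\<close> and \<open>h'\<close> twist the scalar in
        the same way, and \<open>k\<close> undoes \<open>h'\<close>.\<close>
      have "g (scale c x) = scale c (g x)" if cx: "c \<in> F" "x \<in> V" for c x
      proof -
        obtain y where y: "y \<in> V" "h' y = h x" using surj[OF hV[OF cx(2)]] by blast
        have "h (scale c x) = h' (scale c y)"
          using cx y by (simp add: semilinear_scale[OF e] semilinear_scale[OF h'(2)])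
        then show ?thesis using g k cx y by (metis V_scale)
      qed
      moreover have "g (x + y) = g x + g y" if "x \<in> V" "y \<in> V" for x y
        using that g(2) by (simp add: V_add semilinear_add[OF e] semilinear_add[OF d] hV)
      ultimately have "semilinear 0 g" by (simp add: semilinear_def)
      then have "g v = v" using True g(1) by (auto simp: linear_fixed_def)
      then have "k (h v) = v" using g irr(1) by simp
      moreover have "k v = v" using k h'(1) irr(1) by (metis (mono_tags, lifting) S'_def mem_Collect_eq)
      moreover have "inj_on k V"
        using transformation_group_bij[OF tg finite_V k(1)] by (simp add: bij_betw_def)
      ultimately have "h v = v" using hV irr(1) by (metis inj_onD)
      with h(2) show False ..
    qed
    moreover have "e \<in> types S" using h(1) e by (auto simp: types_def)
    ultimately have "r \<noteq> r'" using r' Cons.prems(3) by auto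
    moreover have "card F ^ k \<le> card (linear_fixed S')"
      using Cons.prems(4) card_mono[OF fin fixed_sub] by simp
    from IH[OF this] have "length vs + k + r' \<le> n + m" .
    ultimately show ?thesis using \<open>r \<le> r'\<close> by simp
  qed
qed

section \<open>Signed cyclic shifts\<close>

definition unit_vec :: "'a \<Rightarrow> nat \<Rightarrow> nat \<Rightarrow> 'a" where
  "unit_vec c j = (\<lambda>i. if i = j then c else 0)"

lemma unit_vec_apply [simp]: "unit_vec c j i = (if i = j then c else 0)"
  by (simp add: unit_vec_def)

lemma unit_vec_in_V: "c \<in> F \<Longrightarrow> j < n \<Longrightarrow> unit_vec c j \<in> V"
  by (auto simp: V_iff F_0)

text \<open>Every vector is built up one coordinate at a time, by adding multiples of standard basis
  vectors.\<close>

lemma V_subset_if_unit_vecs: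
  assumes "0 \<in> U" "\<And>x y. x \<in> U \<Longrightarrow> y \<in> U \<Longrightarrow> x + y \<in> U"
    and "\<And>c j. c \<in> F \<Longrightarrow> j < n \<Longrightarrow> unit_vec c j \<in> U"
  shows "V \<subseteq> U"
proof
  fix x assume x: "x \<in> V"
  have "(\<lambda>i. if i < k then x i else 0) \<in> U" if "k \<le> n" for k
    using that
  proof (induction k)
    case 0
    then show ?case using assms(1) by (simp add: zero_fun_def)
  next
    case (Suc k)
    have "(\<lambda>i. if i < Suc k then x i else 0) = (\<lambda>i. if i < k then x i else 0) + unit_vec (x k) k"
      by (auto simp: fun_eq_iff)
    then show ?case using Suc assms(2,3) V_in_F[OF x] by simp
  qed
  moreover have "(\<lambda>i. if i < n then x i else 0) = x" using x by (auto simp: V_iff fun_eq_iff)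
  ultimately show "x \<in> U" by (metis le_refl)
qed

text \<open>The shift \<open>s\<close> is any natural number and acts through its residue modulo
  \<open>n\<close>, so inverse shifts stay within the natural numbers.\<close>

definition signed_shift :: "(nat \<Rightarrow> 'a) \<Rightarrow> nat \<Rightarrow> (nat \<Rightarrow> 'a) \<Rightarrow> nat \<Rightarrow> 'a" where
  "signed_shift t s x = (\<lambda>i. if i < n then t i * x ((i + s) mod n) else 0)"

definition signed_shifts :: "((nat \<Rightarrow> 'a) \<Rightarrow> nat \<Rightarrow> 'a) set" where
  "signed_shifts = {signed_shift t s |t s. \<forall>i. t i = 1 \<or> t i = - 1}"

lemma signed_shiftsI: "(\<And>i. t i = 1 \<or> t i = - 1) \<Longrightarrow> signed_shift t s \<in> signed_shifts"
  by (auto simp: signed_shifts_def)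

lemma signed_shiftsE:
  assumes "h \<in> signed_shifts"
  obtains t s where "h = signed_shift t s" "\<And>i. t i = 1 \<or> t i = - 1"
  using assms by (auto simp: signed_shifts_def)

lemma signed_shift_in_V:
  assumes "\<And>i. t i = 1 \<or> t i = - 1" "x \<in> V"
  shows "signed_shift t s x \<in> V"
  using V_in_F[OF assms(2)] F_minus assms(1) unfolding V_iff signed_shift_def
  by (auto simp: F_mult) (metis mult_1 mult_minus_left)

lemma signed_shift_comp:
  "signed_shift t s (signed_shift t' s' x) =
     signed_shift (\<lambda>i. t i * t' ((i + s) mod n)) (s + s') x"
  by (auto simp: signed_shift_def fun_eq_iff mod_add_left_eq add.assoc)

lemma signed_shift_id:
  assumes "x \<in> V" "n dvd s"
  shows "signed_shift (\<lambda>i. 1) s x = x"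
  using assms by (auto simp: signed_shift_def fun_eq_iff V_iff elim!: dvdE)

lemma transformation_group_signed_shifts:
  assumes "0 < n"
  shows "transformation_group V signed_shifts"
  unfolding transformation_group_def
proof (intro conjI ballI)
  show "h x \<in> V" if "h \<in> signed_shifts" "x \<in> V" for h x
    using that signed_shift_in_V by (auto elim!: signed_shiftsE)
  show "\<exists>h\<in>signed_shifts. \<forall>x\<in>V. h x = x"
    by (intro bexI[of _ "signed_shift (\<lambda>i. 1) 0"] signed_shiftsI) (auto intro: signed_shift_id)
next
  fix g h assume "g \<in> signed_shifts" "h \<in> signed_shifts"
  then obtain t s t' s' where g: "g = signed_shift t s" "\<And>i. t i = 1 \<or> t i = - 1"
    and h: "h = signed_shift t' s'" "\<And>i. t' i = 1 \<or> t' i = - 1"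
    unfolding signed_shifts_def by blast
  have "t i * t' j = 1 \<or> t i * t' j = - 1" for i j
    using g(2)[of i] h(2)[of j] by auto
  then have "signed_shift (\<lambda>i. t i * t' ((i + s) mod n)) (s + s') \<in> signed_shifts"
    by (intro signed_shiftsI) simp
  then show "\<exists>k\<in>signed_shifts. \<forall>x\<in>V. k x = g (h x)"
    by (rule bexI[rotated]) (simp add: g(1) h(1) signed_shift_comp)
next
  fix h assume "h \<in> signed_shifts"
  then obtain t s where h: "h = signed_shift t s" "\<And>i. t i = 1 \<or> t i = - 1"
    unfolding signed_shifts_def by blast
  \<comment> \<open>\<open>s' + s\<close> is a multiple of \<open>n\<close>, so this shift undoes
    \<open>s\<close>. The signs of the composite are squares of values of \<open>t\<close>, hence
    1.\<close>
  define s' where "s' = (n - 1) * s"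
  have "t i * t i = 1" for i using h(2)[of i] by auto
  moreover have "n dvd s' + s" using assms by (auto simp: s'_def gr0_conv_Suc intro!: dvdI[of _ _ s])
  ultimately have "signed_shift (\<lambda>i. t ((i + s') mod n)) s' (h x) = x" if "x \<in> V" for x
    using that by (simp add: h(1) signed_shift_comp signed_shift_id)
  moreover have "signed_shift (\<lambda>i. t ((i + s') mod n)) s' \<in> signed_shifts"
    using h(2) by (intro signed_shiftsI)
  ultimately show "\<exists>k\<in>signed_shifts. \<forall>x\<in>V. k (h x) = x" by blast
qed

lemma semilinear_signed_shift: "semilinear 0 (signed_shift t s)"
  by (auto simp: semilinear_def signed_shift_def fun_eq_iff distrib_left)

lemma two_neq_one: "(2 :: 'a) \<noteq> 1"
  by (metis add_cancel_right_right one_add_one zero_neq_one)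

lemma small_numerals_nonzero:
  assumes "CHAR('a) > 3"
  shows "(2 :: 'a) \<noteq> 0" "(3 :: 'a) \<noteq> 0"
proof -
  have "of_nat k \<noteq> (0 :: 'a)" if "0 < k" "k \<le> 3" for k
    using that assms dvd_imp_le[of "CHAR('a)" k] by (auto simp: of_nat_eq_0_iff_char_dvd)
  from this[of 2] this[of 3] show "(2 :: 'a) \<noteq> 0" "(3 :: 'a) \<noteq> 0" by simp_all
qed

text \<open>For \<open>m = 0\<close> the field has as many elements as there are numbers below the
  characteristic, and these are distinct in it. Scalar multiplication is then repeated
  addition.\<close>

lemma F_eq_of_nat:
  assumes "m = 0" "c \<in> F"
  shows "\<exists>k. c = of_nat k"
proof -
  have "frob e (of_nat k :: 'a) = of_nat k" for e k
    by (induction k) (simp_all add: frob_add)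
  then have "of_nat ` {..<CHAR('a)} \<subseteq> F" by (auto simp: F_def)
  moreover have "inj_on (of_nat :: nat \<Rightarrow> 'a) {..<CHAR('a)}"
  proof (rule linorder_inj_onI)
    fix a b :: nat assume ab: "a < b" "a \<in> {..<CHAR('a)}" "b \<in> {..<CHAR('a)}"
    then have "of_nat (b - a) \<noteq> (0 :: 'a)"
      using dvd_imp_le[of "CHAR('a)" "b - a"] unfolding of_nat_eq_0_iff_char_dvd by auto
    then show "of_nat a \<noteq> (of_nat b :: 'a)" using ab(1) by (simp add: of_nat_diff)
  qed auto
  then have "card (of_nat ` {..<CHAR('a)} :: 'a set) = card F"
    using assms(1) by (simp add: card_image card_F)
  ultimately have "of_nat ` {..<CHAR('a)} = F" using finite_F by (simp add: card_subset_eq)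
  then show ?thesis using assms(2) by blast
qed

text \<open>A nonzero coordinate of a vector in \<open>U\<close> is isolated by a sign change,
  repeated addition supplies all its multiples, and shifts carry them to the other
  coordinates.\<close>

lemma signed_shifts_irreducible:
  assumes "m = 0" "CHAR('a) > 3"
    and U: "U \<subseteq> V" "0 \<in> U" "\<And>x y. x \<in> U \<Longrightarrow> y \<in> U \<Longrightarrow> x + y \<in> U"
      "\<And>h x. h \<in> signed_shifts \<Longrightarrow> x \<in> U \<Longrightarrow> h x \<in> U"
  shows "U = {0} \<or> U = V"
proof (cases "U = {0}")
  case False
  then obtain u where u: "u \<in> U" "u \<noteq> 0" using U(2) by blast
  have uV: "u \<in> V" using u U(1) by blast
  then obtain j where j: "j < n" "u j \<noteq> 0"
    using u(2) by (auto simp: V_iff fun_eq_iff) (metis not_less)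
  define c where "c = 2 * u j"
  have c: "c \<noteq> 0" using small_numerals_nonzero[OF assms(2)] j by (simp add: c_def)
  have cF: "c \<in> F" unfolding c_def mult_2 using V_in_F[OF uV] F_add by blast
  \<comment> \<open>The sum doubles coordinate \<open>j\<close> and cancels all others.\<close>
  have "signed_shift (\<lambda>i. if i = j then 1 else - 1) 0 u + u \<in> U"
    using U(3)[OF U(4)[OF signed_shiftsI u(1)] u(1)] by simp
  also have "signed_shift (\<lambda>i. if i = j then 1 else - 1) 0 u + u = unit_vec c j"
    using uV j by (auto simp: signed_shift_def fun_eq_iff c_def V_iff)
  finally have cU: "unit_vec c j \<in> U" .
  have mult: "unit_vec (of_nat k * c) j \<in> U" for k
  proof (induction k)
    case 0
    have "unit_vec (of_nat 0 * c) j = 0" by (simp add: fun_eq_iff)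
    then show ?case using U(2) by metis
  next
    case (Suc k)
    have "unit_vec (of_nat (Suc k) * c) j = unit_vec (of_nat k * c) j + unit_vec c j"
      by (simp add: fun_eq_iff algebra_simps)
    then show ?case using U(3)[OF Suc cU] by metis
  qed
  have all: "unit_vec d i \<in> U" if d: "d \<in> F" and i: "i < n" for d i
  proof -
    obtain k where "d * inverse c = of_nat k"
      using F_eq_of_nat[OF assms(1) F_mult[OF d F_inverse[OF cF]]] by blast
    then have "d = of_nat k * c" using c by (auto simp: field_simps)
    then have "signed_shift (\<lambda>_. 1) (j + (n - i)) (unit_vec d j) \<in> U"
      using U(4)[OF signed_shiftsI] mult by simp
    \<comment> \<open>The shifted vector at \<open>l\<close> reads position l + j - i modulo
      \<open>n\<close>, which is \<open>j\<close> only for l = i.\<close>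
    moreover have "(l + (j + (n - i))) mod n = j \<longleftrightarrow> l = i" if "l < n" for l
    proof
      assume "(l + (j + (n - i))) mod n = j"
      then show "l = i"
        using i j(1) by (intro mod_add_right_cancel_nat[OF _ that i, of "j + (n - i)"]) simp
    qed (use i j(1) in simp)
    then have "signed_shift (\<lambda>_. 1) (j + (n - i)) (unit_vec d j) = unit_vec d i"
      using i j(1) by (auto simp: signed_shift_def fun_eq_iff)
    ultimately show ?thesis by metis
  qed
  have "V \<subseteq> U" by (rule V_subset_if_unit_vecs[OF U(2,3) all])
  then show ?thesis using U(1) by blast
qed blast

text \<open>For \<open>m = 0\<close> the general bound allows at most \<open>n\<close> points, and
  the group is not trivial. Length \<open>l\<close> is reached by \<open>l - 1\<close> standard
  basis vectors followed by a vector with trivial stabilizer.\<close>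

lemma signed_shifts_irredundant:
  assumes "m = 0" "CHAR('a) > 3" "0 < n"
  shows "length ` {vs. irredundant_on V signed_shifts vs} = {1..n}"
proof -
  note two = small_numerals_nonzero(1)[OF assms(2)]
  have m1: "(- 1 :: 'a) \<noteq> 1" using two by (simp add: minus_equation_iff neg_eq_iff_add_eq_0)
  define flip where "flip j = signed_shift (\<lambda>i. if i = j then - 1 else 1) 0" for j
  have flip_mem: "flip j \<in> signed_shifts" for j
    unfolding flip_def by (rule signed_shiftsI) simp
  have flip_apply: "flip j x i = (if i = j then - x i else x i)" if "x \<in> V" for j x i
    using that by (auto simp: flip_def signed_shift_def V_iff)
  have "length vs \<in> {1..n}" if irr: "irredundant_on V signed_shifts vs" for vs
  proof -
    obtain r where r: "r \<le> m" "types signed_shifts = {e. 2 ^ r dvd e}"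
      using types_eq_multiples[OF transformation_group_signed_shifts[OF assms(3)]] by blast
    have "1 \<le> card (linear_fixed signed_shifts)"
      using linear_fixed_closed(1) finite_subset[OF linear_fixed_sub finite_V]
      by (metis One_nat_def Suc_leI card_gt_0_iff empty_iff)
    then have "length vs + 0 + r \<le> n + m"
      using r(2) irr semilinear_signed_shift
      by (intro irredundant_length_le[OF transformation_group_signed_shifts[OF assms(3)]])
         (auto elim!: signed_shiftsE)
    moreover have "vs \<noteq> []"
    proof
      assume "vs = []"
      then have "\<forall>h\<in>signed_shifts. \<forall>x\<in>V. h x = x" using irr by (simp add: irredundant_on_def)
      then have "flip 0 (unit_vec 1 0) = unit_vec 1 0"
        using flip_mem assms(3) unit_vec_in_V F_1 by blast
      then show False
        using m1 flip_apply[of "unit_vec 1 0" 0 0] assms(3) by (simp add: unit_vec_in_V F_1)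
    qed
    ultimately show ?thesis using assms(1) r(1) by (cases vs) auto
  qed
  moreover have "\<exists>vs. irredundant_on V signed_shifts vs \<and> length vs = l" if l: "l \<in> {1..n}" for l
  proof -
    define w where "w i = (if i < n then if i = n - 1 then 2 else 1 else 0 :: 'a)" for i
    have "(2 :: 'a) \<in> F" using F_add[OF F_1 F_1] by simp
    then have w: "w \<in> V" by (auto simp: w_def V_iff F_1)
    define f where "f i = (if i < l - 1 then unit_vec 1 i else w)" for i
    have fV: "f i \<in> V" for i using l w by (auto simp: f_def F_1 intro: unit_vec_in_V)
    have "irredundant_on V signed_shifts (map f [0..<l])"
      unfolding irredundant_on_def
    proof (intro conjI allI impI ballI)
      show "set (map f [0..<l]) \<subseteq> V" using fV by auto
    next
      fix i assume i: "i < length (map f [0..<l])"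
      \<comment> \<open>A coordinate where \<open>f i\<close> is nonzero and all earlier vectors
        vanish. For \<open>w\<close> the last one serves, since the basis vectors used have index
        below \<open>l - 1\<close>, which is at most \<open>n - 1\<close>.\<close>
      define p where "p = (if i < l - 1 then i else n - 1)"
      have "flip p (f j) = f j" if "j < i" for j
      proof -
        have "f j p = 0" using that i l by (auto simp: f_def p_def)
        then show ?thesis by (simp add: fun_eq_iff flip_apply[OF fV])
      qed
      moreover have "f i p \<noteq> - f i p"
        using i l m1 two by (auto simp: f_def p_def w_def eq_neg_iff_add_eq_0)
      then have "flip p (f i) \<noteq> f i" using flip_apply[OF fV, of p i p] by metis
      ultimately show "\<exists>h\<in>signed_shifts. (\<forall>j<i. h (map f [0..<l] ! j) = map f [0..<l] ! j) \<and>
          h (map f [0..<l] ! i) \<noteq> map f [0..<l] ! i"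
        using i flip_mem by (intro bexI[of _ "flip p"]) auto
    next
      fix h x assume h: "h \<in> signed_shifts" "\<forall>v\<in>set (map f [0..<l]). h v = v" and x: "x \<in> V"
      obtain t s where ts: "h = signed_shift t s" "\<And>i. t i = 1 \<or> t i = - 1"
        using h(1) unfolding signed_shifts_def by blast
      have "f (l - 1) \<in> set (map f [0..<l])" using l by auto
      then have "h w = w" using h(2) by (simp add: f_def)
      then have hw: "t i * w ((i + s) mod n) = w i" if "i < n" for i
        using that ts(1) by (auto simp: signed_shift_def fun_eq_iff split: if_splits)
      \<comment> \<open>If the last position moved, a sign times 1 would equal 2, but 2 is neither 1
        nor -1.\<close>
      have last: "(n - 1 + s) mod n = n - 1"
      proof (rule ccontr)
        assume "(n - 1 + s) mod n \<noteq> n - 1"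
        then have "t (n - 1) = 2" using hw[of "n - 1"] assms(3) by (simp add: w_def)
        then show False
          using ts(2)[of "n - 1"] small_numerals_nonzero[OF assms(2)] two_neq_one
          by (auto simp: eq_neg_iff_add_eq_0)
      qed
      have "(n - 1 + s) mod n = (n - 1) mod n" using last assms(3) by simp
      then have s: "n dvd s" by (subst (asm) mod_eq_dvd_iff_nat) simp_all
      have "(i + s) mod n = i" if "i < n" for i using s that by (auto elim!: dvdE)
      then have "t i = 1" if "i < n" for i
        using hw[OF that] that two by (auto simp: w_def split: if_splits)
      then have "h x = signed_shift (\<lambda>i. 1) s x" by (auto simp: ts(1) signed_shift_def fun_eq_iff)
      then show "h x = x" using signed_shift_id[OF x s] by simp
    qed
    then show ?thesis by (intro exI[of _ "map f [0..<l]"]) simp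
  qed
  ultimately show ?thesis by (auto simp: image_iff) (metis atLeastAtMost_iff)+
qed

section \<open>The semilinear group\<close>

text \<open>The full semilinear group of \<open>V\<close>, with values off \<open>V\<close> left
  free. Injectivity gives bijectivity because \<open>V\<close> is finite.\<close>

definition semilinear_group :: "((nat \<Rightarrow> 'a) \<Rightarrow> nat \<Rightarrow> 'a) set" where
  "semilinear_group = {h. (\<forall>x\<in>V. h x \<in> V) \<and> inj_on h V \<and> (\<exists>e. semilinear e h)}"

lemma semilinear_groupI:
  "(\<And>x. x \<in> V \<Longrightarrow> h x \<in> V) \<Longrightarrow> inj_on h V \<Longrightarrow> semilinear e h \<Longrightarrow> h \<in> semilinear_group"
  by (auto simp: semilinear_group_def)

lemma semilinear_group_surj:
  assumes "h \<in> semilinear_group" "y \<in> V"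
  shows "\<exists>x\<in>V. h x = y"
proof -
  have "h ` V = V"
    using assms(1) by (intro endo_inj_surj finite_V) (auto simp: semilinear_group_def)
  then show ?thesis using assms(2) by (metis imageE)
qed

text \<open>Modulo \<open>2 ^ m\<close> the exponent \<open>e * (2 ^ m - 1)\<close> is the negative
  of \<open>e\<close>, so it names the inverse automorphism.\<close>

lemma frob_inverse_type:
  assumes "c \<in> F"
  shows "frob e (frob (e * (2 ^ m - 1)) c) = c"
proof -
  have "e + e * (2 ^ m - 1) = 2 ^ m * e" by (simp add: algebra_simps)
  then show ?thesis by (simp add: frob_frob frob_period_mult[OF assms])
qed

lemma transformation_group_semilinear_group: "transformation_group V semilinear_group"
  unfolding transformation_group_def
proof (intro conjI ballI)
  have "(\<lambda>x. x) \<in> semilinear_group" by (rule semilinear_groupI[of _ 0]) (auto simp: semilinear_def)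
  then show "\<exists>h\<in>semilinear_group. \<forall>x\<in>V. h x = x" by (rule bexI[rotated]) simp
next
  fix g h assume gh: "g \<in> semilinear_group" "h \<in> semilinear_group"
  then obtain d e where "semilinear d g" "semilinear e h" by (auto simp: semilinear_group_def)
  then have "semilinear (d + e) (\<lambda>x. g (h x))"
    using gh by (intro semilinear_comp[of d g e h]) (auto simp: semilinear_group_def)
  moreover have "inj_on (\<lambda>x. g (h x)) V"
    using gh unfolding semilinear_group_def inj_on_def by blast
  ultimately have "(\<lambda>x. g (h x)) \<in> semilinear_group"
    using gh by (intro semilinear_groupI) (auto simp: semilinear_group_def)
  then show "\<exists>k\<in>semilinear_group. \<forall>x\<in>V. k x = g (h x)" by (rule bexI[rotated]) simp
next
  fix h assume h: "h \<in> semilinear_group"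
  then obtain e where e: "semilinear e h" by (auto simp: semilinear_group_def)
  define k where "k = inv_into V h"
  have kh: "k (h x) = x" if "x \<in> V" for x
    using h that by (simp add: k_def semilinear_group_def)
  have surj: "\<exists>x\<in>V. y = h x" if "y \<in> V" for y using semilinear_group_surj[OF h that] by metis
  have "k (scale c y) = scale (frob (e * (2 ^ m - 1)) c) (k y)" if cy: "c \<in> F" "y \<in> V" for c y
  proof -
    obtain x where x: "x \<in> V" "y = h x" using surj[OF cy(2)] by blast
    have "scale c y = h (scale (frob (e * (2 ^ m - 1)) c) x)"
      using cy x by (simp add: semilinear_scale[OF e] F_frob frob_inverse_type del: One_nat_def)
    then show ?thesis using cy x by (simp add: kh V_scale F_frob)
  qed
  moreover have "k (y + z) = k y + k z" if yz: "y \<in> V" "z \<in> V" for y z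
  proof -
    obtain x x' where "x \<in> V" "y = h x" "x' \<in> V" "z = h x'" using surj yz by metis
    then show ?thesis by (simp add: kh V_add flip: semilinear_add[OF e])
  qed
  ultimately have "semilinear (e * (2 ^ m - 1)) k" by (simp add: semilinear_def)
  moreover have "inj_on k V" by (rule inj_on_inverseI[of _ h]) (use surj kh in metis)
  moreover have "k y \<in> V" if "y \<in> V" for y using surj[OF that] kh by metis
  ultimately have "k \<in> semilinear_group" by (intro semilinear_groupI)
  then show "\<exists>k\<in>semilinear_group. \<forall>x\<in>V. k (h x) = x" using kh by blast
qed (auto simp: semilinear_group_def)

definition frob_vec :: "nat \<Rightarrow> (nat \<Rightarrow> 'a) \<Rightarrow> nat \<Rightarrow> 'a" where
  "frob_vec e x = (\<lambda>i. frob e (x i))"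

lemma semilinear_frob_vec: "semilinear e (frob_vec e)"
  by (simp add: semilinear_def frob_vec_def fun_eq_iff frob_add frob_mult)

lemma frob_vec_in_semilinear_group: "frob_vec e \<in> semilinear_group"
proof (rule semilinear_groupI[OF _ _ semilinear_frob_vec])
  show "frob_vec e x \<in> V" if "x \<in> V" for x
    using that by (auto simp: frob_vec_def V_iff F_frob)
  have "a = b" if "frob e a = frob e (b :: 'a)" for a b
  proof -
    have "frob e (a - b) = 0" using that frob_add[of e a "- b"] by (simp add: frob_minus)
    then show ?thesis by (simp add: frob_def)
  qed
  then show "inj_on (frob_vec e) V"
    by (auto simp: inj_on_def frob_vec_def fun_eq_iff)
qed

text \<open>The set where \<open>g\<close> and \<open>h\<close> agree is closed under addition and
  contains all multiples of standard basis vectors.\<close>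

lemma semilinear_eqI:
  assumes "semilinear e g" "semilinear e h" "\<And>j. j < n \<Longrightarrow> g (unit_vec 1 j) = h (unit_vec 1 j)" "x \<in> V"
  shows "g x = h x"
proof -
  have "V \<subseteq> {x \<in> V. g x = h x}"
  proof (rule V_subset_if_unit_vecs)
    have "f 0 = 0" if "semilinear e f" for f
      using semilinear_add[OF that V_0 V_0] by simp
    then show "0 \<in> {x \<in> V. g x = h x}" using assms(1,2) V_0 by simp
  next
    fix c j assume cj: "c \<in> F" "j < n"
    have "unit_vec c j = scale c (unit_vec 1 j)" by (auto simp: fun_eq_iff)
    then show "unit_vec c j \<in> {x \<in> V. g x = h x}"
      using cj assms(3)[OF cj(2)] unit_vec_in_V[OF F_1 cj(2)]
      by (simp add: V_scale semilinear_scale[OF assms(1)] semilinear_scale[OF assms(2)])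
  qed (auto simp: V_add semilinear_add[OF assms(1)] semilinear_add[OF assms(2)])
  then show ?thesis using assms(4) by blast
qed

section \<open>Linear functionals and transvections\<close>

definition dot :: "(nat \<Rightarrow> 'a) \<Rightarrow> (nat \<Rightarrow> 'a) \<Rightarrow> 'a" where
  "dot f x = (\<Sum>i<n. f i * x i)"

lemma dot_in_F: "f \<in> V \<Longrightarrow> x \<in> V \<Longrightarrow> dot f x \<in> F"
  unfolding dot_def by (intro F_sum F_mult V_in_F)

lemma dot_add: "dot f (x + y) = dot f x + dot f y"
  and dot_diff_left: "dot (f - g) x = dot f x - dot g x"
  and dot_diff: "dot f (x - y) = dot f x - dot f y"
  by (simp_all add: dot_def algebra_simps sum.distrib sum_subtractf)

lemma dot_scale: "dot f (scale c x) = c * dot f x"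
  by (simp add: dot_def sum_distrib_left algebra_simps)

lemma dot_unit_vec: "j < n \<Longrightarrow> dot f (unit_vec c j) = f j * c"
  by (simp add: dot_def if_distrib[of "\<lambda>x. _ * x"] cong: if_cong)

text \<open>The functional \<open>f\<close> takes the value \<open>dot f x * (1 + dot f u)\<close>
  at the image of \<open>x\<close>, so \<open>dot f x\<close>, and with it \<open>x\<close>, can be
  recovered. The condition \<open>ne\<close> also admits dilations, where \<open>dot f u\<close> is
  not 0.\<close>

lemma transvection_in_semilinear_group:
  assumes f: "f \<in> V" and u: "u \<in> V" and ne: "1 + dot f u \<noteq> 0"
  shows "(\<lambda>x. x + scale (dot f x) u) \<in> semilinear_group"
proof (rule semilinear_groupI[of _ 0])
  show "x + scale (dot f x) u \<in> V" if "x \<in> V" for x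
    using that f u by (intro V_add V_scale dot_in_F)
  show "semilinear 0 (\<lambda>x. x + scale (dot f x) u)"
    by (simp add: semilinear_def dot_add dot_scale fun_eq_iff algebra_simps)
  show "inj_on (\<lambda>x. x + scale (dot f x) u) V"
  proof (rule inj_onI)
    fix x y assume eq: "x + scale (dot f x) u = y + scale (dot f y) u"
    have "dot f x * (1 + dot f u) = dot f (x + scale (dot f x) u)"
      by (simp add: dot_add dot_scale algebra_simps)
    also have "\<dots> = dot f y * (1 + dot f u)"
      unfolding eq by (simp add: dot_add dot_scale algebra_simps)
    finally have "dot f x = dot f y" using ne by simp
    then show "x = y" using eq by simp
  qed
qed

text \<open>If \<open>dot f u = 1\<close> and \<open>dot f w\<close> is nonzero, adding
  \<open>dot f x\<close> times \<open>w - u\<close> to \<open>x\<close> sends \<open>u\<close> to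
  \<open>w\<close>; the factor to be nonzero, 1 + \<open>dot f (w - u)\<close>, equals
  \<open>dot f w\<close>.\<close>

lemma semilinear_group_transitive:
  assumes u: "u \<in> V" "u \<noteq> 0" and w: "w \<in> V" "w \<noteq> 0"
  shows "\<exists>h\<in>semilinear_group. h u = w"
proof -
  obtain i where i: "i < n" "u i \<noteq> 0"
    using u by (auto simp: V_iff fun_eq_iff) (metis not_less)
  obtain j where j: "j < n" "w j \<noteq> 0"
    using w by (auto simp: V_iff fun_eq_iff) (metis not_less)
  define a where "a = inverse (u i)"
  have a: "a \<in> F" "a * u i = 1" "a \<noteq> 0"
    using i V_in_F[OF u(1)] by (auto simp: a_def F_inverse)
  have dot_unit: "dot (unit_vec c k) x = c * x k" if "k < n" for c k x
    using that by (simp add: dot_def if_distrib[of "\<lambda>x. x * _"] cong: if_cong)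
  have dot_add_left: "dot (f + g) x = dot f x + dot g x" for f g x
    by (simp add: dot_def algebra_simps sum.distrib)
  \<comment> \<open>One coordinate, rescaled, suffices if \<open>u\<close> and \<open>w\<close> are
    both nonzero at \<open>i\<close> or both at \<open>j\<close>. Otherwise \<open>w i\<close> and
    \<open>u j\<close> vanish, and coordinates \<open>i\<close> and \<open>j\<close> are
    combined.\<close>
  have "\<exists>f\<in>V. dot f u = 1 \<and> dot f w \<noteq> 0"
  proof (cases "w i = 0")
    case False
    then show ?thesis using a i by (intro bexI[of _ "unit_vec a i"]) (auto simp: dot_unit unit_vec_in_V)
  next
    case wi: True
    show ?thesis
    proof (cases "u j = 0")
      case True
      then show ?thesis using a i j wi
        by (intro bexI[of _ "unit_vec a i + unit_vec 1 j"])
           (auto simp: dot_unit dot_add_left unit_vec_in_V V_add F_1)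
    next
      case False
      then show ?thesis using j V_in_F[OF u(1)]
        by (intro bexI[of _ "unit_vec (inverse (u j)) j"]) (auto simp: dot_unit unit_vec_in_V F_inverse)
    qed
  qed
  then obtain f where f: "f \<in> V" "dot f u = 1" "dot f w \<noteq> 0" by blast
  have "(\<lambda>x. x + scale (dot f x) (w - u)) \<in> semilinear_group"
    using f V_add[OF w(1) V_minus[OF u(1)]]
    by (intro transvection_in_semilinear_group) (simp_all add: dot_diff)
  then show ?thesis by (rule bexI[rotated]) (simp add: f(2) fun_eq_iff)
qed

text \<open>The group is transitive on nonzero vectors, so a single one in \<open>U\<close> brings
  in all others.\<close>

lemma semilinear_group_irreducible:
  assumes "U \<subseteq> V" "0 \<in> U" "\<And>h x. h \<in> semilinear_group \<Longrightarrow> x \<in> U \<Longrightarrow> h x \<in> U"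
  shows "U = {0} \<or> U = V"
proof (cases "U = {0}")
  case False
  then obtain u where u: "u \<in> U" "u \<noteq> 0" using assms(2) by blast
  have "w \<in> U" if w: "w \<in> V" for w
  proof (cases "w = 0")
    case False
    then obtain h where "h \<in> semilinear_group" "h u = w"
      using semilinear_group_transitive[of u w] w u assms(1) by blast
    then show ?thesis using assms(3)[of h u] u(1) by simp
  qed (use assms(2) in simp)
  then show ?thesis using assms(1) by blast
qed blast

text \<open>Either some linear functional \<open>g\<close> annihilates the vectors, and a transvection along \<open>g\<close> fixes
  them, or they form a basis, and the Frobenius automorphism acts on coordinates with respect to it.\<close>

lemma exists_semilinear_fixing_list:
  assumes "0 < m" "CHAR('a) > 2" "0 < n" and vs: "set vs \<subseteq> V" "length vs \<le> n"
  shows "\<exists>h\<in>semilinear_group. (\<forall>v\<in>set vs. h v = v) \<and> (\<exists>x\<in>V. h x \<noteq> x)"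
proof -
  \<comment> \<open>Padding with zero vectors gives exactly \<open>n\<close> vectors, so that \<Phi>
    below maps \<open>V\<close> to itself.\<close>
  define v where "v i = (if i < length vs then vs ! i else 0)" for i
  have v: "v i \<in> V" for i using vs(1) V_0 by (auto simp: v_def subset_eq)
  have in_vs: "\<exists>i<n. x = v i" if x: "x \<in> set vs" for x
  proof -
    obtain i where "i < length vs" "x = vs ! i" using x by (auto simp: in_set_conv_nth)
    then show ?thesis using vs(2) by (intro exI[of _ i]) (simp add: v_def)
  qed
  \<comment> \<open>\<Phi> evaluates a functional at all the vectors: a failure of injectivity
    yields a functional that annihilates them, and injectivity yields surjectivity by
    finiteness.\<close>
  define \<Phi> where "\<Phi> f = (\<lambda>i. if i < n then dot f (v i) else 0)" for f
  have \<Phi>V: "\<Phi> f \<in> V" if "f \<in> V" for f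
    unfolding V_iff[of "\<Phi> f"] using that v by (simp add: \<Phi>_def dot_in_F)
  show ?thesis
  proof (cases "inj_on \<Phi> V")
    case False
    then obtain f f' where ff': "f \<in> V" "f' \<in> V" "f \<noteq> f'" "\<Phi> f = \<Phi> f'" by (auto simp: inj_on_def)
    define g where "g = f - f'"
    have g: "g \<in> V" using V_add[OF ff'(1) V_minus[OF ff'(2)]] by (simp add: g_def)
    have dot_g: "dot g (v i) = 0" if "i < n" for i
      using fun_cong[OF ff'(4), of i] that by (simp add: g_def dot_diff_left \<Phi>_def)
    have "g \<noteq> 0" using ff'(3) by (simp add: g_def)
    then obtain j where j: "j < n" "g j \<noteq> 0"
      using g by (auto simp: V_iff fun_eq_iff) (metis not_less)
    \<comment> \<open>With this \<open>c\<close>, \<open>g\<close> takes the value 1 at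
      \<open>unit_vec c j\<close>, so the factor that must be nonzero is 2.\<close>
    define c where "c = inverse (g j)"
    have c: "c \<in> F" "g j * c = 1" "c \<noteq> 0"
      using j V_in_F[OF g] by (auto simp: c_def F_inverse)
    define h where "h x = x + scale (dot g x) (unit_vec c j)" for x
    have "of_nat 2 \<noteq> (0 :: 'a)"
      using assms(2) dvd_imp_le[of "CHAR('a)" 2] unfolding of_nat_eq_0_iff_char_dvd by auto
    then have "h \<in> semilinear_group"
      unfolding h_def using g c j
      by (intro transvection_in_semilinear_group) (auto simp: unit_vec_in_V dot_unit_vec)
    moreover have "h x = x" if "x \<in> set vs" for x
    proof -
      obtain i where i: "i < n" "x = v i" using in_vs[OF \<open>x \<in> set vs\<close>] by blast
      show ?thesis using dot_g[OF i(1)] by (simp add: h_def i(2) fun_eq_iff)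
    qed
    moreover have "h (unit_vec 1 j) j \<noteq> unit_vec 1 j j"
      using j c by (simp add: h_def dot_unit_vec two_neq_one)
    then have "h (unit_vec 1 j) \<noteq> unit_vec 1 j" by metis
    ultimately show ?thesis using unit_vec_in_V[OF F_1 j(1)] by blast
  next
    case True
    then have "\<Phi> ` V = V" using \<Phi>V by (intro endo_inj_surj finite_V) auto
    then have "\<exists>g\<in>V. \<Phi> g = unit_vec 1 j" if "j < n" for j
      using unit_vec_in_V[OF F_1 that] by (metis imageE)
    \<comment> \<open>The functionals \<open>g j\<close> form the dual basis.\<close>
    then obtain g where g: "\<And>j. j < n \<Longrightarrow> g j \<in> V \<and> \<Phi> (g j) = unit_vec 1 j" by metis
    have dual: "dot (g j) (v i) = (if i = j then 1 else 0)" if "i < n" "j < n" for i j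
    proof -
      have "\<Phi> (g j) i = unit_vec 1 j i" using g[OF that(2)] by simp
      then show ?thesis using that by (simp add: \<Phi>_def)
    qed
    \<comment> \<open>\<Psi> turns coordinates into a vector, and the dual functionals read them off
      again, whence its injectivity.\<close>
    define \<Psi> where "\<Psi> c = (\<lambda>k. \<Sum>i<n. c i * v i k)" for c
    have \<Psi>_unit: "\<Psi> (unit_vec 1 j) = v j" if "j < n" for j
      using that by (simp add: \<Psi>_def fun_eq_iff if_distrib[of "\<lambda>x. x * _"] cong: if_cong)
    have \<Psi>: "\<Psi> \<in> semilinear_group"
    proof (rule semilinear_groupI[of _ 0])
      show "\<Psi> c \<in> V" if "c \<in> V" for c
      proof -
        have "v i k = 0" if "n \<le> k" for i k using v[of i] that by (simp add: V_iff)
        then have "\<Psi> c k = 0" if "n \<le> k" for k using that by (simp add: \<Psi>_def)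
        moreover have "\<Psi> c k \<in> F" for k
          unfolding \<Psi>_def by (intro F_sum F_mult V_in_F[OF \<open>c \<in> V\<close>] V_in_F[OF v])
        ultimately show ?thesis unfolding V_iff[of "\<Psi> c"] by blast
      qed
      show "semilinear 0 \<Psi>"
        by (simp add: semilinear_def \<Psi>_def fun_eq_iff sum.distrib sum_distrib_left algebra_simps)
      have dot_\<Psi>: "dot (g j) (\<Psi> c) = c j" if "j < n" for c j
      proof -
        have "dot (g j) (\<Psi> c) = (\<Sum>i<n. c i * dot (g j) (v i))"
          unfolding dot_def \<Psi>_def sum_distrib_left
          by (subst sum.swap) (simp add: algebra_simps)
        also have "\<dots> = (\<Sum>i<n. if i = j then c j else 0)"
          using dual that by (intro sum.cong) auto
        finally show ?thesis using that by simp
      qed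
      show "inj_on \<Psi> V"
      proof (rule inj_onI)
        fix x y assume xy: "x \<in> V" "y \<in> V" "\<Psi> x = \<Psi> y"
        have "x i = y i" for i
          using xy dot_\<Psi>[of i x] dot_\<Psi>[of i y] by (cases "i < n") (auto simp: V_iff)
        then show "x = y" by (rule ext)
      qed
    qed
    obtain k where k: "k \<in> semilinear_group" "\<And>x. x \<in> V \<Longrightarrow> k (\<Psi> x) = x"
      using transformation_group_inv[OF transformation_group_semilinear_group \<Psi>] by blast
    \<comment> \<open>The maps \<open>l\<close> and \<open>h\<close> compose to the Frobenius
      conjugated by \<Psi>, which fixes each \<open>v j\<close> because its coordinates are 0 and
      1.\<close>
    obtain l where l: "l \<in> semilinear_group" "\<And>x. x \<in> V \<Longrightarrow> l x = frob_vec 1 (k x)"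
      using transformation_group_comp[OF transformation_group_semilinear_group frob_vec_in_semilinear_group[of 1] k(1)] by blast
    obtain h where h: "h \<in> semilinear_group" "\<And>x. x \<in> V \<Longrightarrow> h x = \<Psi> (l x)"
      using transformation_group_comp[OF transformation_group_semilinear_group \<Psi> l(1)] by blast
    have \<Psi>V: "\<Psi> x \<in> V" if "x \<in> V" for x using \<Psi> that by (auto simp: semilinear_group_def)
    have h\<Psi>: "h (\<Psi> x) = \<Psi> (frob_vec 1 x)" if "x \<in> V" for x
      using that by (simp add: h l k \<Psi>V)
    have frob_unit: "frob_vec 1 (unit_vec c j) = unit_vec (frob 1 c) j" for c j
      by (auto simp: frob_vec_def fun_eq_iff)
    have "h (v j) = v j" if "j < n" for j
      using h\<Psi>[OF unit_vec_in_V[OF F_1 that]] by (simp add: frob_unit \<Psi>_unit[OF that] del: One_nat_def)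
    moreover have "\<exists>x\<in>V. h x \<noteq> x"
    proof -
      have "card {c :: 'a. frob 1 c = c} = CHAR('a)"
        using card_frobenius_fixed_field[OF prime_char, of 1] by (simp add: frob_def)
      \<comment> \<open>As \<open>m\<close> is positive, \<open>F\<close> exceeds the prime field,
        so the Frobenius moves one of its elements.\<close>
      moreover have "card F > CHAR('a)"
      proof -
        have "(1 :: nat) < 2 ^ m" by (intro one_less_power assms) simp
        then have "CHAR('a) ^ 1 < CHAR('a) ^ 2 ^ m"
          using assms(2) by (intro power_strict_increasing) auto
        then show ?thesis by (simp add: card_F)
      qed
      moreover have "finite {c :: 'a. frob 1 c = c}"
        using calculation(1) char_pos by (metis card_gt_0_iff)
      ultimately obtain c where c: "c \<in> F" "frob 1 c \<noteq> c"
        by (metis (mono_tags, lifting) card_mono linorder_not_le mem_Collect_eq subsetI)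
      have "unit_vec c 0 0 \<noteq> unit_vec (frob 1 c) 0 0" using c by simp
      then have "unit_vec c 0 \<noteq> unit_vec (frob 1 c) 0" by metis
      then have "h (\<Psi> (unit_vec c 0)) \<noteq> \<Psi> (unit_vec c 0)"
        using \<Psi> c assms(3) h\<Psi>[OF unit_vec_in_V[OF c(1) assms(3)]]
        by (auto simp: frob_unit semilinear_group_def inj_on_def unit_vec_in_V F_frob simp del: One_nat_def)
      then show ?thesis using \<Psi>V[OF unit_vec_in_V[OF c(1) assms(3)]] by blast
    qed
    ultimately show ?thesis using h(1) in_vs by blast
  qed
qed

text \<open>\<alpha> is taken from the fixed field of \<open>frob (2 ^ s)\<close> outside the
  smaller one of \<open>frob (2 ^ (s - 1))\<close>. The exponents fixing it are the multiples of
  some \<open>2 ^ r\<close>, and this choice forces \<open>r = s\<close>.\<close>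

lemma exists_frobenius_level:
  assumes "0 < s" "s \<le> m"
  shows "\<exists>\<alpha>\<in>F. \<forall>e. frob e \<alpha> = \<alpha> \<longleftrightarrow> 2 ^ s dvd e"
proof -
  define E where "E i = {c :: 'a. frob (2 ^ i) c = c}" for i
  have card_E: "card (E i) = CHAR('a) ^ 2 ^ i" for i
    unfolding E_def frob_def by (rule card_frobenius_fixed_field[OF prime_char]) simp
  have p: "CHAR('a) > 1" using prime_gt_1_nat[OF prime_char] .
  have "card (E (s - 1)) < card (E s)"
    unfolding card_E using p assms(1) by (intro power_strict_increasing) auto
  moreover have "finite (E (s - 1))" using card_E[of "s - 1"] p by (metis card_gt_0_iff gr_zeroI power_eq_0_iff not_less_zero)
  ultimately obtain \<alpha> where \<alpha>: "\<alpha> \<in> E s" "\<alpha> \<notin> E (s - 1)"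
    by (metis card_mono linorder_not_le subsetI)
  obtain r where r: "r \<le> s" "{e. frob e \<alpha> = \<alpha>} = {e. 2 ^ r dvd e}"
  proof -
    have "\<exists>r\<le>s. {e. frob e \<alpha> = \<alpha>} = {e. 2 ^ r dvd e}"
    proof (rule multiples_of_power_of_two)
      show "a + b \<in> {e. frob e \<alpha> = \<alpha>}" if "a \<in> {e. frob e \<alpha> = \<alpha>}" "b \<in> {e. frob e \<alpha> = \<alpha>}" for a b
        using that by (simp flip: frob_frob)
      show "e \<in> {e. frob e \<alpha> = \<alpha>}" if "e + 2 ^ s \<in> {e. frob e \<alpha> = \<alpha>}" for e
        using that \<alpha>(1) by (simp add: E_def flip: frob_frob)
      show "2 ^ s \<in> {e. frob e \<alpha> = \<alpha>}" using \<alpha>(1) by (simp add: E_def)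
    qed
    then show ?thesis using that by blast
  qed
  then have iff: "frob e \<alpha> = \<alpha> \<longleftrightarrow> 2 ^ r dvd e" for e by blast
  have "\<not> 2 ^ r dvd (2 :: nat) ^ (s - 1)" using \<alpha>(2) iff by (simp add: E_def)
  then have "\<not> r \<le> s - 1" using le_imp_power_dvd by blast
  then have "r = s" using r(1) by simp
  moreover have "\<alpha> \<in> F" using iff \<open>r = s\<close> assms(2) by (simp add: F_def le_imp_power_dvd)
  ultimately show ?thesis using iff by blast
qed

text \<open>The general bound gives at most \<open>n + m\<close> points, and \<open>n\<close>
  vectors are always fixed by some nontrivial element. For length \<open>n + j\<close>, the standard
  basis is followed by \<open>j\<close> multiples of one basis vector whose scalars generate growing
  subfields.\<close>

lemma semilinear_group_irredundant:
  assumes "0 < m" "CHAR('a) > 2" "0 < n"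
  shows "length ` {vs. irredundant_on V semilinear_group vs} = {n + 1..n + m}"
proof -
  have "length vs \<in> {n + 1..n + m}" if irr: "irredundant_on V semilinear_group vs" for vs
  proof -
    obtain r where r: "types semilinear_group = {e. 2 ^ r dvd e}"
      using types_eq_multiples[OF transformation_group_semilinear_group] by blast
    have "1 \<le> card (linear_fixed semilinear_group)"
      using linear_fixed_closed(1) finite_subset[OF linear_fixed_sub finite_V]
      by (metis One_nat_def Suc_leI card_gt_0_iff empty_iff)
    then have "length vs + 0 + r \<le> n + m"
      using r irr
      by (intro irredundant_length_le[OF transformation_group_semilinear_group])
         (auto simp: semilinear_group_def)
    moreover have "\<not> length vs \<le> n"
      using exists_semilinear_fixing_list[OF assms, of vs] irr
      unfolding irredundant_on_def by blast
    ultimately show ?thesis by simp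
  qed
  moreover have "\<exists>vs. irredundant_on V semilinear_group vs \<and> length vs = l" if "l \<in> {n + 1..n + m}" for l
  proof -
    define j where "j = l - n"
    have j: "1 \<le> j" "j \<le> m" "l = n + j" using that by (auto simp: j_def)
    \<comment> \<open>The levels are 1, ..., j - 1 and finally \<open>m\<close>: they increase
      strictly, and the last leaves only the trivial automorphism of \<open>F\<close>.\<close>
    define lev where "lev t = (if t = j - 1 then m else t + 1)" for t
    have "\<exists>\<alpha>\<in>F. \<forall>e. frob e \<alpha> = \<alpha> \<longleftrightarrow> 2 ^ lev t dvd e" if "t < j" for t
      using that j by (intro exists_frobenius_level) (auto simp: lev_def)
    then obtain \<alpha> where \<alpha>: "\<And>t. t < j \<Longrightarrow> \<alpha> t \<in> F"
      "\<And>t e. t < j \<Longrightarrow> frob e (\<alpha> t) = \<alpha> t \<longleftrightarrow> 2 ^ lev t dvd e"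
      by metis
    define f where "f i = (if i < n then unit_vec 1 i else unit_vec (\<alpha> (i - n)) 0)" for i
    have fV: "f i \<in> V" if "i < l" for i
      using that j(3) \<alpha>(1) assms(3) by (auto simp: f_def F_1 intro!: unit_vec_in_V)
    have frob_unit: "frob_vec e (unit_vec c i) = unit_vec c i \<longleftrightarrow> frob e c = c" for e c i
      by (auto simp: frob_vec_def fun_eq_iff)
    have "irredundant_on V semilinear_group (map f [0..<l])"
      unfolding irredundant_on_def
    proof (intro conjI allI impI ballI)
      show "set (map f [0..<l]) \<subseteq> V" using fV by auto
    next
      fix i assume i: "i < length (map f [0..<l])"
      have "\<exists>h\<in>semilinear_group. (\<forall>k<i. h (f k) = f k) \<and> h (f i) \<noteq> f i"
      proof (cases "i < n")
        case True
        \<comment> \<open>This doubles coordinate \<open>i\<close> and fixes the other standard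
          basis vectors.\<close>
        define h where "h x = x + scale (dot (unit_vec 1 i) x) (unit_vec 1 i)" for x
        have "of_nat 2 \<noteq> (0 :: 'a)"
          using assms(2) dvd_imp_le[of "CHAR('a)" 2] unfolding of_nat_eq_0_iff_char_dvd by auto
        then have "h \<in> semilinear_group"
          unfolding h_def using True
          by (intro transvection_in_semilinear_group) (auto simp: unit_vec_in_V F_1 dot_unit_vec)
        moreover have "h (f k) = f k" if "k < i" for k
          using True that by (simp add: h_def f_def dot_unit_vec fun_eq_iff)
        moreover have "h (f i) i \<noteq> f i i"
          using True by (simp add: h_def f_def dot_unit_vec two_neq_one)
        then have "h (f i) \<noteq> f i" by metis
        ultimately show ?thesis by blast
      next
        case False
        define t where "t = i - n"
        have t: "t < j" "i = n + t" using i False j by (auto simp: t_def)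
        have lev: "0 < lev t" using assms(1) by (simp add: lev_def)
        \<comment> \<open>Earlier levels are at most \<open>lev t - 1\<close>, so this exponent
          fixes all earlier scalars but not \<open>\<alpha> t\<close>.\<close>
        define e where "e = (2 :: nat) ^ (lev t - 1)"
        have "frob_vec e (f k) = f k" if "k < i" for k
        proof (cases "k < n")
          case True
          then show ?thesis by (simp add: f_def frob_unit)
        next
          case False
          then have "lev (k - n) \<le> lev t - 1" using that t j by (auto simp: lev_def)
          then show ?thesis
            using False that t by (simp add: f_def frob_unit \<alpha>(2) e_def le_imp_power_dvd)
        qed
        moreover have "\<not> 2 ^ lev t dvd e"
        proof
          assume "2 ^ lev t dvd e"
          then have "lev t \<le> lev t - 1" unfolding e_def by (rule power_dvd_imp_le) simp
          then show False using lev by simp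
        qed
        then have "frob_vec e (f i) \<noteq> f i"
          using t by (simp add: f_def frob_unit \<alpha>(2))
        ultimately show ?thesis using frob_vec_in_semilinear_group by blast
      qed
      then show "\<exists>h\<in>semilinear_group. (\<forall>k<i. h (map f [0..<l] ! k) = map f [0..<l] ! k) \<and>
          h (map f [0..<l] ! i) \<noteq> map f [0..<l] ! i"
        using i by auto
    next
      fix h x assume h: "h \<in> semilinear_group" "\<forall>v\<in>set (map f [0..<l]). h v = v" and x: "x \<in> V"
      have hf: "h (f i) = f i" if "i < l" for i using h(2) that by auto
      obtain e where e: "semilinear e h" using h(1) by (auto simp: semilinear_group_def)
      \<comment> \<open>Fixing the standard basis makes \<open>h\<close> the coordinatewise
        Frobenius power of its type.\<close>
      have h_eq: "h y = frob_vec e y" if "y \<in> V" for y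
      proof (rule semilinear_eqI[OF e semilinear_frob_vec _ that])
        fix i assume "i < n"
        then show "h (unit_vec 1 i) = frob_vec e (unit_vec 1 i)"
          using hf[of i] j(3) frob_unit[of e 1 i] by (simp add: f_def)
      qed
      have last: "n + (j - 1) < l" using j by simp
      have "frob_vec e (unit_vec (\<alpha> (j - 1)) 0) = unit_vec (\<alpha> (j - 1)) 0"
        using hf[OF last] h_eq[OF fV[OF last]] by (simp add: f_def)
      then have "2 ^ m dvd e" using \<alpha>(2)[of "j - 1" e] j by (simp add: frob_unit lev_def)
      then obtain k where "e = 2 ^ m * k" by (elim dvdE)
      then have "frob_vec e x = x"
        using V_in_F[OF x] by (simp add: frob_vec_def fun_eq_iff frob_period_mult)
      then show "h x = x" using h_eq[OF x] by simp
    qed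
    then show ?thesis by (intro exI[of _ "map f [0..<l]"]) simp
  qed
  ultimately show ?thesis by (auto simp: image_iff) (metis atLeastAtMost_iff)+
qed

end

section \<open>Choice of parameters in characteristic 5\<close>

lemma CHAR_alg_closure_gf5: "CHAR(gf5 alg_closure) = 5"
  by (simp add: CHAR_gf5)

theorem theorem1p2:
  fixes X :: "nat set" and a b :: nat
  assumes "2 \<le> a" and "a \<le> b" and "X = {a..b}"
  shows "\<exists>(\<Omega> :: nat set) (G :: (nat \<Rightarrow> nat) set).
           primitive_permutation_group G \<Omega> \<and> irredundant_base_sizes G \<Omega> = X"
proof -
  define F where "F m = {c :: gf5 alg_closure. frob (2 ^ m) c = c}" for m
  define V where "V m n = {x :: nat \<Rightarrow> gf5 alg_closure. (\<forall>i<n. x i \<in> F m) \<and> (\<forall>i\<ge>n. x i = 0)}" for m n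
  have space: "frobenius_space m n (F m) (V m n)" for m n
    by standard (simp_all only: F_def V_def CHAR_alg_closure_gf5, simp)
  show ?thesis
  proof (cases "a = 2")
    case True
    \<comment> \<open>Signed shifts give the lengths 1, ..., n, and passing to the affine group adds
      one.\<close>
    define n where "n = b - 1"
    have n: "0 < n" "b = Suc n" using assms True by (auto simp: n_def)
    interpret frobenius_space 0 n "F 0" "V 0 n" by (rule space)
    have nz: "unit_vec 1 0 \<in> V 0 n" "unit_vec 1 0 \<noteq> (0 :: nat \<Rightarrow> gf5 alg_closure)"
      using n unit_vec_in_V[OF F_1] by (auto simp: fun_eq_iff)
    have "\<exists>(\<Omega> :: nat set) G. primitive_permutation_group G \<Omega> \<and>
        irredundant_base_sizes G \<Omega> = (\<lambda>vs. Suc (length vs)) ` {vs. irredundant_on (V 0 n) signed_shifts vs}"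
    proof (rule exists_primitive_affine_group[OF finite_V V_0 nz V_add V_minus
          transformation_group_signed_shifts[OF n(1)]])
      show "h (x + y) = h x + h y" if "h \<in> signed_shifts" "x \<in> V 0 n" "y \<in> V 0 n" for h x y
        using that semilinear_add[OF semilinear_signed_shift] by (auto simp: signed_shifts_def)
      show "U = {0} \<or> U = V 0 n"
        if "U \<subseteq> V 0 n" "0 \<in> U" "\<And>x y. x \<in> U \<Longrightarrow> y \<in> U \<Longrightarrow> x + y \<in> U"
          "\<And>h x. h \<in> signed_shifts \<Longrightarrow> x \<in> U \<Longrightarrow> h x \<in> U" for U
        using that CHAR_alg_closure_gf5 by (intro signed_shifts_irreducible) simp_all
    qed
    then obtain \<Omega> :: "nat set" and G where G: "primitive_permutation_group G \<Omega>"
      "irredundant_base_sizes G \<Omega> = (\<lambda>vs. Suc (length vs)) ` {vs. irredundant_on (V 0 n) signed_shifts vs}"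
      by blast
    have "length ` {vs. irredundant_on (V 0 n) signed_shifts vs} = {1..n}"
      using CHAR_alg_closure_gf5 n by (intro signed_shifts_irredundant) simp_all
    then have "irredundant_base_sizes G \<Omega> = Suc ` {1..n}" using G(2) by (metis image_image)
    then show ?thesis using G(1) n True assms(3) by (auto simp: image_Suc_atLeastAtMost numeral_2_eq_2)
  next
    case False
    \<comment> \<open>The semilinear group gives n + 1, ..., n + m, and the affine group adds one,
      so the sizes run from n + 2 = a to n + m + 1 = b.\<close>
    define n where "n = a - 2"
    define m where "m = b - a + 1"
    have nm: "0 < n" "0 < m" "a = n + 2" "b = n + m + 1"
      using assms False by (auto simp: n_def m_def)
    interpret frobenius_space m n "F m" "V m n" by (rule space)
    have nz: "unit_vec 1 0 \<in> V m n" "unit_vec 1 0 \<noteq> (0 :: nat \<Rightarrow> gf5 alg_closure)"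
      using nm unit_vec_in_V[OF F_1] by (auto simp: fun_eq_iff)
    have "\<exists>(\<Omega> :: nat set) G. primitive_permutation_group G \<Omega> \<and>
        irredundant_base_sizes G \<Omega> = (\<lambda>vs. Suc (length vs)) ` {vs. irredundant_on (V m n) semilinear_group vs}"
    proof (rule exists_primitive_affine_group[OF finite_V V_0 nz V_add V_minus
          transformation_group_semilinear_group])
      show "h (x + y) = h x + h y" if "h \<in> semilinear_group" "x \<in> V m n" "y \<in> V m n" for h x y
        using that semilinear_add by (auto simp: semilinear_group_def)
      show "U = {0} \<or> U = V m n"
        if "U \<subseteq> V m n" "0 \<in> U" "\<And>h x. h \<in> semilinear_group \<Longrightarrow> x \<in> U \<Longrightarrow> h x \<in> U" for U
        using that by (rule semilinear_group_irreducible)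
    qed
    then obtain \<Omega> :: "nat set" and G where G: "primitive_permutation_group G \<Omega>"
      "irredundant_base_sizes G \<Omega> = (\<lambda>vs. Suc (length vs)) ` {vs. irredundant_on (V m n) semilinear_group vs}"
      by blast
    have "length ` {vs. irredundant_on (V m n) semilinear_group vs} = {n + 1..n + m}"
      using CHAR_alg_closure_gf5 nm by (intro semilinear_group_irredundant) simp_all
    then have "irredundant_base_sizes G \<Omega> = Suc ` {n + 1..n + m}" using G(2) by (metis image_image)
    then show ?thesis using G(1) nm assms(3) by (auto simp: image_Suc_atLeastAtMost)
  qed
qed

end
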